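(* Let $\rho$ be a Drinfeld $\mathbb{F}_q[t]$-module of rank $r$ over $\overline{k}$ with $\rho_t=\theta+\kappa_1\tau+\cdots+\kappa_{r-1}\tau^{r-1}+\tau^r$, let $\omega_1,\dots,\omega_r$ be an $A$-basis of $\Lambda_\rho$, and let $s=[K_\rho:k]$. Suppose $u_1,\dots,u_n\in\mathbb{C}_\infty$ satisfy $\exp_\rho(u_i)=\alpha_i\in\overline{k}$ and $\dim_{K_\rho}\mathrm{Span}_{K_\rho}(\omega_1,\dots,\omega_r,u_1,\dots,u_n)=r/s+n$. Then the classes of the $t$-motives $X_{\alpha_1},\dots,X_{\alpha_n}$ in $\mathrm{Ext}^1(\mathbf{1},M_\rho)$ are linearly independent over $\mathrm{End}(M_\rho)$. Explicitly: for any $E_1,\dots,E_n\in\mathrm{Mat}_r(\overline{k}(t))$, not all zero, with $\Phi_\rho E_i=E_i^{(-1)}\Phi_\rho$ for each $i$, there is no row vector $\gamma\in\mathrm{Mat}_{1\times r}(\overline{k}(t))$ with $\gamma^{(-1)}\Phi_\rho+\sum_{i=1}^n\mathbf{h}_{\alpha_i}^{\mathrm{tr}}E_i=\gamma$, where $\mathbf{h}_\alpha^{\mathrm{tr}}=(\alpha,0,\dots,0)$.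
   Context: $\mathbb{F}_q$ is the field with $q$ elements, $\theta,t$ independent variables, $A=\mathbb{F}_q[\theta]$, $k=\mathbb{F}_q(\theta)$, $\mathbb{C}_\infty$ the completion of an algebraic closure of $\mathbb{F}_q((1/\theta))$, $\overline{k}$ the algebraic closure of $k$ in $\mathbb{C}_\infty$. For $f=\sum a_it^i\in\mathbb{C}_\infty((t))$, $f^{(n)}=\sum a_i^{q^n}t^i$ (entrywise on matrices; $c^{(n)}=c^{q^n}$ on constants). $\tau$ is the $q$-power Frobenius, $\mathbb{C}_\infty[\tau]$ the twisted polynomial ring acting by $(\sum c_i\tau^i)(x)=\sum c_ix^{q^i}$; $\rho$ is the $\mathbb{F}_q$-algebra map $\mathbb{F}_q[t]\to\overline{k}[\tau]$ determined by $\rho_t$. $\exp_\rho$ is the unique entire $\mathbb{F}_q$-linear series $z+\sum_{i\ge1}\alpha_iz^{q^i}$ with $\exp_\rho(\theta z)=\rho_t(\exp_\rho(z))$; $\Lambda_\rho=\ker\exp_\rho$ is free of rank $r$ over $A$; $K_\rho$ is the fraction field of $\{c\in\mathbb{C}_\infty:c\Lambda_\rho\subseteq\Lambda_\rho\}$. $\Phi_\rho\in\mathrm{Mat}_r(\overline{k}[t])$ has entries $1$ at $(i,i+1)$, $1\le i\le r-1$, last row $(t-\theta,-\kappa_1^{(-1)},\dots,-\kappa_{r-1}^{(-(r-1))})$, zeros elsewhere. Pre-$t$-motives are left modules over the twisted ring $\overline{k}(t)[\sigma,\sigma^{-1}]$ ($\sigma f=f^{(-1)}\sigma$) finite-dimensional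 over $\overline{k}(t)$. $M_\rho=\overline{k}(t)^r$ with $\sigma\mathbf{m}=\Phi_\rho\mathbf{m}$; $\mathbf{1}=\overline{k}(t)$ with $\sigma$ acting by $f\mapsto f^{(-1)}$; $X_\alpha=\overline{k}(t)^{r+1}$ with $\sigma$ given by $\begin{pmatrix}\Phi_\rho&0\\ \mathbf{h}_\alpha^{\mathrm{tr}}&1\end{pmatrix}$, an extension of $\mathbf{1}$ by $M_\rho$. Endomorphisms of $M_\rho$ are $\mathbf{m}\mapsto E\mathbf{m}$ with $\Phi_\rho E=E^{(-1)}\Phi_\rho$; the push-out of an extension with $\sigma$-matrix $\begin{pmatrix}\Phi_\rho&0\\ \mathbf{v}&1\end{pmatrix}$ along $E$ has matrix $\begin{pmatrix}\Phi_\rho&0\\ \mathbf{v}E&1\end{pmatrix}$, Baer sum adds the rows $\mathbf{v}$, and such an extension is trivial iff there is $\gamma\in\mathrm{Mat}_{1\times r}(\overline{k}(t))$ with $\gamma^{(-1)}\Phi_\rho+\mathbf{v}=\gamma$. *)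

theory Defs
  imports Main "HOL-Computational_Algebra.Polynomial" "HOL-Computational_Algebra.Fraction_Field"
begin

definition nonarch_absv :: "('c::field \<Rightarrow> real) \<Rightarrow> bool" where
  "nonarch_absv absv \<longleftrightarrow>
     (\<forall>x. absv x \<ge> 0) \<and> (\<forall>x. absv x = 0 \<longleftrightarrow> x = 0) \<and>
     (\<forall>x y. absv (x * y) = absv x * absv y) \<and>
     (\<forall>x y. absv (x + y) \<le> max (absv x) (absv y))"

definition conv_absv :: "('c::field \<Rightarrow> real) \<Rightarrow> (nat \<Rightarrow> 'c) \<Rightarrow> 'c \<Rightarrow> bool" where
  "conv_absv absv X L \<longleftrightarrow> (\<forall>e>0. \<exists>N. \<forall>n\<ge>N. absv (X n - L) < e)"

definition sums_absv :: "('c::field \<Rightarrow> real) \<Rightarrow> (nat \<Rightarrow> 'c) \<Rightarrow> 'c \<Rightarrow> bool" where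
  "sums_absv absv f s \<longleftrightarrow> conv_absv absv (\<lambda>n. \<Sum>i<n. f i) s"

definition complete_absv :: "('c::field \<Rightarrow> real) \<Rightarrow> bool" where
  "complete_absv absv \<longleftrightarrow>
     (\<forall>X. (\<forall>e>0. \<exists>N. \<forall>m\<ge>N. \<forall>n\<ge>N. absv (X m - X n) < e) \<longrightarrow> (\<exists>L. conv_absv absv X L))"

definition alg_closed_field :: "'c::field itself \<Rightarrow> bool" where
  "alg_closed_field _ \<longleftrightarrow> (\<forall>p :: 'c poly. degree p > 0 \<longrightarrow> (\<exists>x. poly p x = 0))"

definition Fq :: "nat \<Rightarrow> 'c::field set" where
  "Fq q = {x. x ^ q = x}"

definition Aset :: "nat \<Rightarrow> 'c::field \<Rightarrow> 'c set" where
  "Aset q \<theta> = {poly a \<theta> | a. \<forall>i. coeff a i \<in> Fq q}"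

definition kset :: "nat \<Rightarrow> 'c::field \<Rightarrow> 'c set" where
  "kset q \<theta> = {x / y | x y. x \<in> Aset q \<theta> \<and> y \<in> Aset q \<theta> \<and> y \<noteq> 0}"

definition kbar :: "nat \<Rightarrow> 'c::field \<Rightarrow> 'c set" where
  "kbar q \<theta> = {x. \<exists>p. p \<noteq> 0 \<and> (\<forall>i. coeff p i \<in> kset q \<theta>) \<and> poly p x = 0}"

text \<open>('c, q, theta, absv) is (isometrically isomorphic to) C_infinity: a complete,
  algebraically closed non-archimedean valued field of characteristic p, q = p^e,
  theta transcendental over F_q with |theta| > 1 (so the absolute value restricted to
  k is the infinite one), and the algebraic closure of k dense.\<close>
definition Cinf_data :: "nat \<Rightarrow> 'c::field \<Rightarrow> ('c \<Rightarrow> real) \<Rightarrow> bool" where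
  "Cinf_data q \<theta> absv \<longleftrightarrow>
     (\<exists>p e. prime p \<and> e > 0 \<and> q = p ^ e \<and> CHAR('c) = p) \<and>
     nonarch_absv absv \<and> complete_absv absv \<and> alg_closed_field TYPE('c) \<and>
     (\<forall>a. a \<noteq> 0 \<longrightarrow> (\<forall>i. coeff a i \<in> Fq q) \<longrightarrow> poly a \<theta> \<noteq> 0) \<and>
     absv \<theta> > 1 \<and>
     (\<forall>x. \<forall>e>0. \<exists>y\<in>kbar q \<theta>. absv (x - y) < e)"

definition rho_t :: "nat \<Rightarrow> 'c::field \<Rightarrow> nat \<Rightarrow> (nat \<Rightarrow> 'c) \<Rightarrow> 'c \<Rightarrow> 'c" where
  "rho_t q \<theta> r \<kappa> x = \<theta> * x + (\<Sum>i\<in>{1..<r}. \<kappa> i * x ^ (q ^ i)) + x ^ (q ^ r)"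

definition is_exp_rho :: "nat \<Rightarrow> 'c::field \<Rightarrow> ('c \<Rightarrow> real) \<Rightarrow> nat \<Rightarrow> (nat \<Rightarrow> 'c) \<Rightarrow> ('c \<Rightarrow> 'c) \<Rightarrow> bool" where
  "is_exp_rho q \<theta> absv r \<kappa> expo \<longleftrightarrow>
     (\<exists>\<alpha>. \<alpha> 0 = 1 \<and> (\<forall>z. sums_absv absv (\<lambda>i. \<alpha> i * z ^ (q ^ i)) (expo z))) \<and>
     (\<forall>z. expo (\<theta> * z) = rho_t q \<theta> r \<kappa> (expo z))"

definition Lambda :: "('c \<Rightarrow> 'c::field) \<Rightarrow> 'c set" where
  "Lambda expo = {z. expo z = 0}"

definition is_A_basis :: "nat \<Rightarrow> 'c::field \<Rightarrow> 'c set \<Rightarrow> nat \<Rightarrow> (nat \<Rightarrow> 'c) \<Rightarrow> bool" where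
  "is_A_basis q \<theta> L r \<omega> \<longleftrightarrow>
     (\<forall>i<r. \<omega> i \<in> L) \<and>
     (\<forall>l\<in>L. \<exists>!a. (\<forall>i<r. a i \<in> Aset q \<theta>) \<and> (\<forall>i\<ge>r. a i = 0) \<and> l = (\<Sum>i<r. a i * \<omega> i))"

definition EndLam :: "'c::field set \<Rightarrow> 'c set" where
  "EndLam L = {c. \<forall>l\<in>L. c * l \<in> L}"

definition K_rho :: "'c::field set \<Rightarrow> 'c set" where
  "K_rho L = {x / y | x y. x \<in> EndLam L \<and> y \<in> EndLam L \<and> y \<noteq> 0}"

definition span_over :: "'c::field set \<Rightarrow> 'c set \<Rightarrow> 'c set" where
  "span_over F S = {x. \<exists>B c. finite B \<and> B \<subseteq> S \<and> (\<forall>b\<in>B. c b \<in> F) \<and> x = (\<Sum>b\<in>B. c b * b)}"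

definition dim_over :: "'c::field set \<Rightarrow> 'c set \<Rightarrow> nat" where
  "dim_over F S = (LEAST n. \<exists>B. finite B \<and> card B = n \<and> B \<subseteq> span_over F S \<and>
                                 span_over F S \<subseteq> span_over F B)"

definition twist_c :: "nat \<Rightarrow> int \<Rightarrow> 'c::field \<Rightarrow> 'c" where
  "twist_c q n c = (if n \<ge> 0 then c ^ (q ^ nat n) else (THE y. y ^ (q ^ nat (- n)) = c))"

definition twist_poly :: "nat \<Rightarrow> int \<Rightarrow> 'c::field poly \<Rightarrow> 'c poly" where
  "twist_poly q n p = map_poly (twist_c q n) p"

definition twist_rat :: "nat \<Rightarrow> int \<Rightarrow> 'c::field poly fract \<Rightarrow> 'c poly fract" where
  "twist_rat q n f = (let ab = (SOME ab. snd ab \<noteq> 0 \<and> f = Fract (fst ab) (snd ab))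
                      in Fract (twist_poly q n (fst ab)) (twist_poly q n (snd ab)))"

definition const_rat :: "'c::field \<Rightarrow> 'c poly fract" where
  "const_rat c = Fract [:c:] 1"

definition t_rat :: "'c::field poly fract" where
  "t_rat = Fract [:0, 1:] 1"

definition kbar_t :: "nat \<Rightarrow> 'c::field \<Rightarrow> 'c poly fract set" where
  "kbar_t q \<theta> = {Fract a b | a b. b \<noteq> 0 \<and> (\<forall>i. coeff a i \<in> kbar q \<theta>) \<and> (\<forall>i. coeff b i \<in> kbar q \<theta>)}"

definition Phi_rho :: "nat \<Rightarrow> 'c::field \<Rightarrow> nat \<Rightarrow> (nat \<Rightarrow> 'c) \<Rightarrow> nat \<Rightarrow> nat \<Rightarrow> 'c poly fract" where
  "Phi_rho q \<theta> r \<kappa> i j =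
     (if i = r - 1 then
        (if j = 0 then t_rat - const_rat \<theta> else - const_rat (twist_c q (- int j) (\<kappa> j)))
      else if j = i + 1 then 1 else 0)"

end

theory Submission
  imports Defs "HOL-Computational_Algebra.Polynomial_Factorial" "HOL-Algebra.Embedded_Algebras"
begin

text \<open>Suppose \<open>\<gamma>\<close> trivialises \<open>\<Sum>\<^sub>i E\<^sub>i X\<^sub>\<alpha>\<^sub>i\<close>. The common denominator of \<open>\<gamma>\<close> and the \<open>E\<^sub>i\<close> is invariant
  under twisting, so everything may be multiplied into \<open>\<complex>\<^sub>\<infinity>[t]\<close>. The dual \<open>t\<close>-motive \<open>\<complex>\<^sub>\<infinity>[t]\<^sup>r\<close>, with
  \<open>\<sigma>\<close> acting on row vectors by \<open>f \<mapsto> f\<^sup>(\<^sup>-\<^sup>1\<^sup>)\<Phi>\<close>, has a quotient map \<open>\<epsilon>\<close> to \<open>\<complex>\<^sub>\<infinity>\<close> that kills \<open>\<sigma> - 1\<close> and turns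
  multiplication by \<open>t\<close> into \<open>\<rho>\<^sub>t\<close>. Applying \<open>\<epsilon>\<close> to the trivialisation gives \<open>\<Sum>\<^sub>i P\<^sub>i(\<alpha>\<^sub>i) = 0\<close>, where
  \<open>P\<^sub>i(x) = \<epsilon>(x e\<^sub>1 E\<^sub>i)\<close> is a polynomial commuting with \<open>\<rho>\<^sub>t\<close>, nonzero if \<open>E\<^sub>i\<close> is. By the functional
  equation of the exponential, \<open>P\<^sub>i(exp z) = exp(b\<^sub>i z)\<close> with \<open>b\<^sub>i\<close> the linear coefficient of \<open>P\<^sub>i\<close>, so
  \<open>b\<^sub>i\<close> is an endomorphism of \<open>\<Lambda>\<close> and \<open>\<Sum>\<^sub>i b\<^sub>i u\<^sub>i \<in> \<Lambda>\<close>. As \<open>b\<^sub>i\<close> vanishes only if \<open>P\<^sub>i\<close> does, this contradicts the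
  assumption on the dimension.\<close>

hide_const (open) Module.module.smult UnivPoly.up_ring.coeff UnivPoly.up_ring.monom

section \<open>Twisting\<close>

text \<open>Twisting uses only the \<open>q\<close>-power map: additivity makes it injective,
  because a field has no nilpotents, and surjectivity then provides the inverse Frobenius.\<close>

locale perfect_frobenius =
  fixes q :: nat and ty :: "'c::field itself"
  assumes q_ge_2: "q \<ge> 2"
    and frob_add: "\<And>x y :: 'c. (x + y) ^ q = x ^ q + y ^ q"
    and frob_surj: "\<And>x :: 'c. \<exists>y. y ^ q = x"
begin

lemma q_pos [simp]: "q > 0"
  using q_ge_2 by simp

lemma zero_frob [simp]: "(0 :: 'c) ^ q ^ j = 0" "(0 :: 'c) ^ q = 0"
  by simp_all

lemma frob_power_add: "(x + y :: 'c) ^ q ^ j = x ^ q ^ j + y ^ q ^ j"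
  by (induction j arbitrary: x y) (simp_all add: power_mult frob_add)

lemma frob_power_minus: "(- x :: 'c) ^ q ^ j = - (x ^ q ^ j)"
proof -
  have "x ^ q ^ j + (- x) ^ q ^ j = 0"
    by (simp flip: frob_power_add)
  then show ?thesis by (simp add: eq_neg_iff_add_eq_0 add.commute)
qed

lemma frob_power_diff: "(x - y :: 'c) ^ q ^ j = x ^ q ^ j - y ^ q ^ j"
  using frob_power_add[of x "- y" j] by (simp add: frob_power_minus)

lemma frob_power_inj: "(x :: 'c) ^ q ^ j = y ^ q ^ j \<longleftrightarrow> x = y"
proof
  assume "x ^ q ^ j = y ^ q ^ j"
  then have "(x - y) ^ q ^ j = 0" by (simp add: frob_power_diff)
  then show "x = y" by simp
qed simp

lemma frob_power_surj: "\<exists>y :: 'c. y ^ q ^ j = x"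
proof (induction j arbitrary: x)
  case (Suc j)
  obtain z where "z ^ q = x" using frob_surj by blast
  moreover obtain y where "y ^ q ^ j = z" using Suc by blast
  ultimately show ?case by (metis mult.commute power_Suc power_mult)
qed auto

text \<open>For \<open>j > 0\<close> the twist by \<open>- j\<close> is a definite description; it
  denotes the root because the Frobenius power is bijective.\<close>

lemma twist_c_neg_power: "twist_c q (- int j) (c :: 'c) ^ q ^ j = c"
proof (cases "j = 0")
  case False
  have "\<exists>!y :: 'c. y ^ q ^ j = c"
    using frob_power_surj[of j c] frob_power_inj[of _ j] by metis
  from theI'[OF this] False show ?thesis by (simp add: twist_c_def)
qed (simp add: twist_c_def)

abbreviation untw :: "'c \<Rightarrow> 'c" where "untw \<equiv> twist_c q (-1)"

lemma untw_power [simp]: "untw c ^ q = c"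
  using twist_c_neg_power[of 1 c] by simp

lemma untw_eqI: "y ^ q = c \<Longrightarrow> untw c = y"
  using frob_power_inj[of "untw c" 1 y] by simp

lemma untw_simps [simp]:
  "untw 0 = 0" "untw 1 = 1" "untw (x ^ q) = x"
  "untw (x + y) = untw x + untw y" "untw (x * y) = untw x * untw y"
  "untw (- x) = - untw x" "untw (x - y) = untw x - untw y"
  using q_ge_2 frob_power_minus[of _ 1] frob_power_diff[of _ _ 1]
  by (auto intro!: untw_eqI simp: frob_add power_mult_distrib)

lemma untw_eq_0_iff [simp]: "untw x = 0 \<longleftrightarrow> x = 0"
  using untw_power[of x] by fastforce

section \<open>Twists of polynomials\<close>

definition tw :: "nat \<Rightarrow> 'c poly \<Rightarrow> 'c poly" where
  "tw j = map_poly (\<lambda>x. x ^ q ^ j)"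

abbreviation utw :: "'c poly \<Rightarrow> 'c poly" where
  "utw \<equiv> twist_poly q (-1)"

lemma coeff_tw [simp]: "coeff (tw j p) i = coeff p i ^ q ^ j"
  by (simp add: tw_def coeff_map_poly)

lemma coeff_utw [simp]: "coeff (utw p) i = untw (coeff p i)"
  by (simp add: twist_poly_def coeff_map_poly)

lemma tw_pCons [simp]: "tw j (pCons a p) = pCons (a ^ q ^ j) (tw j p)"
  by (simp add: tw_def map_poly_pCons)

lemma utw_pCons [simp]: "utw (pCons a p) = pCons (untw a) (utw p)"
  by (simp add: twist_poly_def map_poly_pCons)

lemma tw_0_right [simp]: "tw j 0 = 0" by (simp add: tw_def)
lemma utw_0_right [simp]: "utw 0 = 0" by (simp add: twist_poly_def)
lemma utw_1 [simp]: "utw 1 = 1" by (simp add: twist_poly_def)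
lemma tw_0_left [simp]: "tw 0 p = p" by (simp add: tw_def)

lemma tw_add [simp]: "tw j (a + b) = tw j a + tw j b"
  by (rule poly_eqI) (simp add: frob_power_add)
lemma tw_diff [simp]: "tw j (a - b) = tw j a - tw j b"
  by (rule poly_eqI) (simp add: frob_power_diff)
lemma tw_smult [simp]: "tw j (smult c a) = smult (c ^ q ^ j) (tw j a)"
  by (rule poly_eqI) (simp add: power_mult_distrib)
lemma tw_mult [simp]: "tw j (a * b) = tw j a * tw j b"
  by (induction a) simp_all

lemma utw_add [simp]: "utw (a + b) = utw a + utw b"
  by (rule poly_eqI) simp
lemma utw_smult [simp]: "utw (smult c a) = smult (untw c) (utw a)"
  by (rule poly_eqI) simp
lemma utw_mult [simp]: "utw (a * b) = utw a * utw b"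
  by (induction a) simp_all

lemma tw_Suc_utw [simp]: "tw (Suc j) (utw p) = tw j p"
  by (rule poly_eqI) (simp add: power_mult)
lemma utw_tw_Suc [simp]: "utw (tw (Suc j) p) = tw j p"
  by (rule poly_eqI) (simp add: power_mult mult.commute[of q])

lemma tw_eq_0_iff [simp]: "tw j p = 0 \<longleftrightarrow> p = 0"
  by (auto simp: poly_eq_iff)
lemma utw_eq_0_iff [simp]: "utw p = 0 \<longleftrightarrow> p = 0"
  by (auto simp: poly_eq_iff)

lemma degree_tw [simp]: "degree (tw j p) = degree p"
  by (simp add: tw_def degree_map_poly)
lemma poly_tw: "poly (tw j p) (x ^ q ^ j) = poly p x ^ q ^ j"
  by (induction p) (simp_all add: frob_power_add power_mult_distrib)

end


section \<open>The Drinfeld module and its dual motive\<close>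

locale drinfeld = perfect_frobenius q ty
  for q :: nat and ty :: "'c::field itself" +
  fixes \<theta> :: 'c and r :: nat and \<kappa> :: "nat \<Rightarrow> 'c"
  assumes r_pos: "r \<ge> 1"
begin

abbreviation rho :: "'c \<Rightarrow> 'c" where "rho \<equiv> rho_t q \<theta> r \<kappa>"

definition kap :: "nat \<Rightarrow> 'c" where "kap j = twist_c q (- int j) (\<kappa> j)"

lemma kap_power [simp]: "kap j ^ q ^ j = \<kappa> j"
  by (simp add: kap_def twist_c_neg_power)

lemma rho_add: "rho (x + y) = rho x + rho y"
  by (simp add: rho_t_def frob_power_add algebra_simps sum.distrib)

lemma rho_0 [simp]: "rho 0 = 0"
  by (simp add: rho_t_def)

lemma rho_sum: "rho (sum f A) = (\<Sum>x\<in>A. rho (f x))"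
  by (induction A rule: infinite_finite_induct) (simp_all add: rho_add)

text \<open>Substitutes the operator \<open>rho\<close> for \<open>t\<close>: a sum of terms
  \<open>a_i t^i\<close> goes to the sum of the i-fold iterates of \<open>rho\<close> at
  \<open>a_i\<close>. The map is additive but not linear over the field.\<close>

definition ev :: "'c poly \<Rightarrow> 'c" where
  "ev p = fold_coeffs (\<lambda>a b. a + rho b) p 0"

lemma ev_0 [simp]: "ev 0 = 0" by (simp add: ev_def)

lemma ev_pCons [simp]: "ev (pCons a p) = a + rho (ev p)"
  by (cases "a = 0 \<and> p = 0") (auto simp: ev_def)

lemma ev_add [simp]: "ev (a + b) = ev a + ev b"
  by (induction a b rule: poly_induct2) (simp_all add: rho_add)

lemma ev_diff [simp]: "ev (a - b) = ev a - ev b"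
  using ev_add[of "a - b" b] by (simp add: algebra_simps)

text \<open>\<open>rho\<close> commutes with its own iterates, so applying it to the value is the
  same as applying it to every coefficient; the right-hand side is that coefficientwise application,
  written out with twists.\<close>

lemma rho_ev:
  "rho (ev y) = ev (smult \<theta> y) + (\<Sum>l\<in>{1..<r}. ev (smult (\<kappa> l) (tw l y))) + ev (tw r y)"
proof (induction y)
  case (pCons a y)
  have "rho (ev (pCons a y)) = rho a + rho (rho (ev y))"
    by (simp add: rho_add)
  also have "rho (rho (ev y)) = rho (ev (smult \<theta> y)) +
      (\<Sum>l\<in>{1..<r}. rho (ev (smult (\<kappa> l) (tw l y)))) + rho (ev (tw r y))"
    by (subst pCons.IH) (simp add: rho_add rho_sum)
  finally show ?case
    by (simp add: rho_t_def[of q \<theta> r \<kappa> a] sum.distrib algebra_simps)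
qed simp

text \<open>The \<open>\<sigma>\<close>-action on row vectors, \<open>f \<mapsto> f\<^sup>(\<^sup>-\<^sup>1\<^sup>)\<Phi>\<close>.\<close>
definition sig :: "(nat \<Rightarrow> 'c poly) \<Rightarrow> nat \<Rightarrow> 'c poly" where
  "sig f l = (if l = 0 then [:- \<theta>, 1:] * utw (f (r - 1))
     else utw (f (l - 1)) - smult (kap l) (utw (f (r - 1))))"

text \<open>The quotient map of the dual motive by \<open>\<sigma> - 1\<close>.\<close>
definition eps :: "(nat \<Rightarrow> 'c poly) \<Rightarrow> 'c" where
  "eps f = (\<Sum>l<r. ev (tw l (f l)))"

lemma eps_cong: "(\<And>l. l < r \<Longrightarrow> f l = g l) \<Longrightarrow> eps f = eps g"
  by (simp add: eps_def)

lemma eps_add: "eps (\<lambda>l. f l + g l) = eps f + eps g"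
  by (simp add: eps_def sum.distrib)

lemma eps_sum: "eps (\<lambda>l. \<Sum>x\<in>A. f x l) = (\<Sum>x\<in>A. eps (f x))"
proof (induction A rule: infinite_finite_induct)
  case (insert x F)
  then show ?case by (simp add: eps_add)
qed (simp_all add: eps_def)

lemma rho_eps: "rho (eps f) = eps (\<lambda>l. pCons 0 (f l))"
  by (simp add: eps_def rho_sum)

text \<open>Twisting entry \<open>l\<close> of \<open>sig f\<close> by \<open>l\<close> undoes the
  inverse twist and shifts the entries of \<open>f\<close> by one place. The terms coming from the
  last entry of \<open>f\<close> combine by \<open>rho_ev\<close> and leave exactly
  \<open>ev (tw r y)\<close>, the entry lost in the shift.\<close>

lemma eps_sig: "eps (sig f) = eps f"
proof -
  define y where "y = utw (f (r - 1))"
  have split: "(\<Sum>l<r. h l) = h 0 + (\<Sum>l\<in>{1..<r}. h l)" for h :: "nat \<Rightarrow> 'c"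
    using r_pos by (simp add: lessThan_atLeast0 sum.atLeast_Suc_lessThan)
  have "eps (sig f) = ev ([:- \<theta>, 1:] * y) + (\<Sum>l\<in>{1..<r}. ev (tw l (sig f l)))"
    unfolding eps_def split by (simp add: sig_def y_def)
  also have "ev ([:- \<theta>, 1:] * y) = rho (ev y) - ev (smult \<theta> y)"
    by simp
  also have "(\<Sum>l\<in>{1..<r}. ev (tw l (sig f l))) =
      (\<Sum>l\<in>{1..<r}. ev (tw (l - 1) (f (l - 1)))) - (\<Sum>l\<in>{1..<r}. ev (smult (\<kappa> l) (tw l y)))"
    unfolding sum_subtractf[symmetric]
  proof (rule sum.cong)
    fix l assume "l \<in> {1..<r}"
    then obtain m where "l = Suc m" by (cases l) auto
    then show "ev (tw l (sig f l)) = ev (tw (l - 1) (f (l - 1))) - ev (smult (\<kappa> l) (tw l y))"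
      using kap_power[of l] by (simp add: sig_def y_def del: kap_power power_Suc)
  qed simp
  also have "(\<Sum>l\<in>{1..<r}. ev (tw (l - 1) (f (l - 1)))) = (\<Sum>l<r-1. ev (tw l (f l)))"
    by (rule sum.reindex_bij_witness[of _ Suc "\<lambda>l. l - 1"]) auto
  also have "tw r y = tw (r - 1) (f (r - 1))"
    using tw_Suc_utw[of "r - 1" "f (r - 1)"] r_pos by (simp add: y_def)
  then have "rho (ev y) = ev (smult \<theta> y) + (\<Sum>l\<in>{1..<r}. ev (smult (\<kappa> l) (tw l y)))
      + ev (tw (r - 1) (f (r - 1)))"
    using rho_ev[of y] by simp
  finally have "eps (sig f) = (\<Sum>l<r-1. ev (tw l (f l))) + ev (tw (r - 1) (f (r - 1)))"
    by simp
  also have "\<dots> = eps f"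
    using r_pos sum.lessThan_Suc[of "\<lambda>l. ev (tw l (f l))" "r - 1"] by (simp add: eps_def)
  finally show ?thesis .
qed

lemma sig_smult: "sig (\<lambda>l. smult (c ^ q) (f l)) = (\<lambda>l. smult c (sig f l))"
  by (rule ext) (simp add: sig_def smult_diff_right mult.commute)

section \<open>Polynomials attached to rows\<close>

definition rho_poly :: "'c poly" where
  "rho_poly = [:0, \<theta>:] + (\<Sum>i\<in>{1..<r}. monom (\<kappa> i) (q ^ i)) + monom 1 (q ^ r)"

lemma poly_rho_poly [simp]: "poly rho_poly x = rho x"
  by (simp add: rho_poly_def rho_t_def poly_monom poly_sum mult.commute)

lemma degree_rho_poly: "degree rho_poly = q ^ r"
proof -
  have "degree ([:0, \<theta>:] + (\<Sum>i\<in>{1..<r}. monom (\<kappa> i) (q ^ i))) < q ^ r"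
  proof (intro degree_add_less degree_sum_less)
    show "degree [:0, \<theta>:] < q ^ r"
      using r_pos one_less_power[of q r] q_ge_2 by simp
    fix i assume "i \<in> {1..<r}"
    then have "q ^ i < q ^ r" using q_ge_2 by (auto intro: power_strict_increasing)
    then show "degree (monom (\<kappa> i) (q ^ i)) < q ^ r"
      using degree_monom_le le_less_trans by blast
  qed simp
  then show ?thesis
    unfolding rho_poly_def by (subst degree_add_eq_right) (simp_all add: degree_monom_eq)
qed

text \<open>Makes the scalar in \<open>ev (smult (x ^ q ^ l) p)\<close> the variable of a genuine
  polynomial, so that degrees and numbers of roots can be used.\<close>

definition ev_poly :: "nat \<Rightarrow> 'c poly \<Rightarrow> 'c poly" where
  "ev_poly l p = fold_coeffs (\<lambda>a b. monom a (q ^ l) + pcompose rho_poly b) p 0"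

lemma ev_poly_0 [simp]: "ev_poly l 0 = 0" by (simp add: ev_poly_def)

lemma coeff_rho_poly_0: "coeff rho_poly 0 = 0"
  using poly_rho_poly[of 0] by (simp add: poly_0_coeff_0)

lemma ev_poly_pCons [simp]:
  "ev_poly l (pCons a p) = monom a (q ^ l) + pcompose rho_poly (ev_poly l p)"
  by (cases "a = 0 \<and> p = 0") (auto simp: ev_poly_def coeff_rho_poly_0 pcompose_0')

lemma poly_ev_poly: "poly (ev_poly l p) x = ev (smult (x ^ q ^ l) p)"
  by (induction p) (simp_all add: poly_monom poly_pcompose mult.commute)

text \<open>Composition with \<open>rho_poly\<close> multiplies the degree by \<open>q ^ r\<close>,
  which keeps it above the degree \<open>q ^ l\<close> of the monomial added at each step.\<close>

lemma degree_ev_poly: "p \<noteq> 0 \<Longrightarrow> degree (ev_poly l p) = q ^ (l + r * degree p)"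
proof (induction p)
  case (pCons a p)
  show ?case
  proof (cases "p = 0")
    case True
    with pCons show ?thesis by (auto simp: degree_monom_eq pcompose_0' coeff_rho_poly_0)
  next
    case False
    have "degree (pcompose rho_poly (ev_poly l p)) = q ^ (l + r * degree (pCons a p))"
      using False pCons.IH by (simp add: degree_pcompose degree_rho_poly power_add algebra_simps)
    moreover have "q ^ l < q ^ (l + r * degree (pCons a p))"
      using False q_ge_2 r_pos by (auto intro!: power_strict_increasing)
    then have "degree (monom a (q ^ l)) < q ^ (l + r * degree (pCons a p))"
      using degree_monom_le le_less_trans by blast
    ultimately show ?thesis by (simp add: degree_add_eq_right)
  qed
qed simp

text \<open>The endomorphism of the Drinfeld module induced by a matrix with first row
  \<open>f\<close>, as a polynomial. The row enters twisted because \<open>eps\<close> twists entry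
  \<open>l\<close> by \<open>l\<close>.\<close>

definition row_poly :: "(nat \<Rightarrow> 'c poly) \<Rightarrow> 'c poly" where
  "row_poly f = (\<Sum>l<r. ev_poly l (tw l (f l)))"

lemma poly_row_poly: "poly (row_poly f) x = eps (\<lambda>l. smult x (f l))"
  by (simp add: row_poly_def eps_def poly_sum poly_ev_poly)

lemma coeff_row_poly_0: "coeff (row_poly f) 0 = 0"
  by (simp add: poly_row_poly eps_def flip: poly_0_coeff_0)

text \<open>The degrees of the nonzero summands are distinct: their exponents differ modulo \<open>r\<close>.\<close>
lemma row_poly_nonzero:
  assumes "l0 < r" "f l0 \<noteq> 0"
  shows "row_poly f \<noteq> 0"
proof -
  define d where "d l = l + r * degree (f l)" for l
  define A where "A = {l. l < r \<and> f l \<noteq> 0}"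
  have A: "finite A" "A \<noteq> {}" using assms by (auto simp: A_def)
  obtain m where m: "m \<in> A" and max: "\<And>l. l \<in> A \<Longrightarrow> d l \<le> d m"
    using Max_in[of "d ` A"] Max_ge[of "d ` A"] A by (metis (no_types, lifting) empty_is_image finite_imageI image_iff)
  have deg: "degree (ev_poly l (tw l (f l))) = q ^ d l" if "l \<in> A" for l
    using that by (simp add: A_def degree_ev_poly d_def)
  have "d l < d m" if "l \<in> A" "l \<noteq> m" for l
  proof -
    have "d l \<noteq> d m"
    proof
      assume "d l = d m"
      then have "d l mod r = d m mod r" by simp
      with that m show False by (simp add: d_def A_def)
    qed
    with max[OF that(1)] show ?thesis by simp
  qed
  then have "coeff (ev_poly l (tw l (f l))) (q ^ d m) = 0" if "l < r" "l \<noteq> m" for l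
    using that q_ge_2 deg[of l]
    by (cases "l \<in> A") (auto simp: A_def intro!: coeff_eq_0 power_strict_increasing)
  then have "coeff (row_poly f) (q ^ d m) = (\<Sum>l<r. if l = m then coeff (ev_poly m (tw m (f m))) (q ^ d m) else 0)"
    unfolding row_poly_def coeff_sum by (intro sum.cong) auto
  also have "\<dots> = lead_coeff (ev_poly m (tw m (f m)))"
    using m deg[OF m] by (simp add: A_def)
  \<comment> \<open>The degree is a power of \<open>q\<close>, hence positive, so this is not the
    zero polynomial.\<close>
  also have "\<dots> \<noteq> 0"
    using deg[OF m] by (auto simp del: degree_0 leading_coeff_0_iff) (metis degree_0 leading_coeff_0_iff less_irrefl power_eq_0_iff q_pos)
  finally show ?thesis by auto
qed

text \<open>Each row is \<open>sig\<close> of the previous one and \<open>eps\<close> does not see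
  \<open>sig\<close>; moving the scalar inside \<open>sig\<close> raises it to the
  \<open>q\<close>-th power, once per row.\<close>

lemma eps_row:
  assumes row: "\<And>m l. Suc m < r \<Longrightarrow> l < r \<Longrightarrow> M (Suc m) l = sig (M m) l"
    and "m < r"
  shows "eps (\<lambda>l. smult c (M m l)) = eps (\<lambda>l. smult (c ^ q ^ m) (M 0 l))"
  using \<open>m < r\<close>
proof (induction m arbitrary: c)
  case (Suc m)
  have "eps (\<lambda>l. smult c (M (Suc m) l)) = eps (\<lambda>l. smult c (sig (M m) l))"
    using Suc.prems by (intro eps_cong) (simp add: row)
  also have "\<dots> = eps (\<lambda>l. smult (c ^ q) (M m l))"
    by (simp add: eps_sig flip: sig_smult)
  also have "\<dots> = eps (\<lambda>l. smult (c ^ q ^ Suc m) (M 0 l))"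
    using Suc by (simp add: power_mult)
  finally show ?case .
qed simp

lemma smult_sum_right: "smult c (sum f A) = (\<Sum>x\<in>A. smult c (f x))"
  by (induction A rule: infinite_finite_induct) (simp_all add: smult_add_right)

text \<open>Through \<open>eps\<close>, \<open>rho\<close> is multiplication by \<open>t\<close>.
  The assumption \<open>last\<close> rewrites \<open>t\<close> times row 0 as \<theta> times row 0,
  plus the rows \<open>m\<close> with factors \<open>kap m\<close>, plus \<open>sig\<close> of the
  last row; \<open>eps_row\<close> brings all of them back to row 0, where the scalars add up to
  \<open>rho x\<close>.\<close>

lemma row_poly_commute:
  assumes row: "\<And>m l. Suc m < r \<Longrightarrow> l < r \<Longrightarrow> M (Suc m) l = sig (M m) l"
    and last: "\<And>l. l < r \<Longrightarrow> [:- \<theta>, 1:] * M 0 l =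
      (\<Sum>m\<in>{1..<r}. smult (kap m) (M m l)) + sig (M (r - 1)) l"
  shows "rho (poly (row_poly (M 0)) x) = poly (row_poly (M 0)) (rho x)"
proof -
  have "rho (poly (row_poly (M 0)) x) = eps (\<lambda>l. pCons 0 (smult x (M 0 l)))"
    by (simp add: poly_row_poly rho_eps)
  also have "\<dots> = eps (\<lambda>l. (smult (x * \<theta>) (M 0 l) + (\<Sum>m\<in>{1..<r}. smult (x * kap m) (M m l)))
      + smult x (sig (M (r - 1)) l))"
  proof (rule eps_cong)
    fix l assume "l < r"
    have "pCons 0 (smult x (M 0 l)) = smult x ([:- \<theta>, 1:] * M 0 l) + smult (x * \<theta>) (M 0 l)"
      by (simp add: smult_diff_right)
    also have "\<dots> = smult (x * \<theta>) (M 0 l) + (\<Sum>m\<in>{1..<r}. smult (x * kap m) (M m l))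
        + smult x (sig (M (r - 1)) l)"
      unfolding last[OF \<open>l < r\<close>] by (simp add: smult_add_right smult_sum_right)
    finally show "pCons 0 (smult x (M 0 l)) = \<dots>" .
  qed
  also have "\<dots> = eps (\<lambda>l. smult (x * \<theta>) (M 0 l))
      + (\<Sum>m\<in>{1..<r}. eps (\<lambda>l. smult (x * kap m) (M m l))) + eps (\<lambda>l. smult x (sig (M (r - 1)) l))"
    by (simp add: eps_add eps_sum)
  also have "(\<Sum>m\<in>{1..<r}. eps (\<lambda>l. smult (x * kap m) (M m l)))
      = (\<Sum>m\<in>{1..<r}. eps (\<lambda>l. smult (\<kappa> m * x ^ q ^ m) (M 0 l)))"
  proof (rule sum.cong)
    fix m assume "m \<in> {1..<r}"
    then show "eps (\<lambda>l. smult (x * kap m) (M m l)) = eps (\<lambda>l. smult (\<kappa> m * x ^ q ^ m) (M 0 l))"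
      by (subst eps_row[of M, OF row]) (simp_all add: power_mult_distrib mult.commute)
  qed simp
  also have "eps (\<lambda>l. smult x (sig (M (r - 1)) l)) = eps (\<lambda>l. smult (x ^ q) (M (r - 1) l))"
    by (simp add: eps_sig flip: sig_smult)
  also have "\<dots> = eps (\<lambda>l. smult ((x ^ q) ^ q ^ (r - 1)) (M 0 l))"
    using r_pos by (intro eps_row row) auto
  also have "(x ^ q) ^ q ^ (r - 1) = x ^ q ^ r"
    using r_pos by (simp flip: power_mult power_Suc)
  also have "eps (\<lambda>l. smult (x * \<theta>) (M 0 l))
      + (\<Sum>m\<in>{1..<r}. eps (\<lambda>l. smult (\<kappa> m * x ^ q ^ m) (M 0 l)))
      + eps (\<lambda>l. smult (x ^ q ^ r) (M 0 l)) = eps (\<lambda>l. smult (rho x) (M 0 l))"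
    by (simp add: rho_t_def smult_add_left smult_sum eps_add eps_sum mult.commute)
  finally show ?thesis by (simp add: poly_row_poly)
qed

end


section \<open>The exponential function\<close>

locale nonarch_field =
  fixes absv :: "'c::field \<Rightarrow> real"
  assumes absv: "nonarch_absv absv"
begin

lemma absv_nonneg [simp]: "absv x \<ge> 0"
  and absv_eq_0_iff [simp]: "absv x = 0 \<longleftrightarrow> x = 0"
  and absv_mult: "absv (x * y) = absv x * absv y"
  and absv_add: "absv (x + y) \<le> max (absv x) (absv y)"
  using absv by (auto simp: nonarch_absv_def)

lemma absv_zero [simp]: "absv 0 = 0"
  by simp

lemma absv_one [simp]: "absv 1 = 1"
  using absv_mult[of 1 1] by simp

lemma absv_minus [simp]: "absv (- x) = absv x"
proof -
  have "absv (- 1) * absv (- 1) = 1" by (simp flip: absv_mult)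
  then have "absv (- 1) = 1"
    by (metis absv_nonneg abs_of_nonneg abs_square_eq_1 power2_eq_square)
  then show ?thesis using absv_mult[of "- 1" x] by simp
qed

lemma absv_diff: "absv (x - y) \<le> max (absv x) (absv y)"
  using absv_add[of x "- y"] by simp

lemma absv_power: "absv (x ^ n) = absv x ^ n"
  by (induction n) (simp_all add: absv_mult)

lemma absv_sum_le:
  "0 \<le> B \<Longrightarrow> (\<And>x. x \<in> A \<Longrightarrow> absv (f x) \<le> B) \<Longrightarrow> absv (sum f A) \<le> B"
proof (induction A rule: infinite_finite_induct)
  case (insert x A)
  then show ?case using absv_add[of "f x" "sum f A"] by fastforce
qed simp_all

lemma conv_absv_bound:
  assumes "conv_absv absv X L" and "\<And>n. n \<ge> N \<Longrightarrow> absv (X n - c) \<le> B"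
  shows "absv (L - c) \<le> B"
proof (rule field_le_epsilon)
  fix e :: real assume "e > 0"
  then obtain M where M: "\<And>n. n \<ge> M \<Longrightarrow> absv (X n - L) < e"
    using assms(1) by (auto simp: conv_absv_def)
  define n where "n = max M N"
  have "absv (L - c) \<le> max (absv (X n - c)) (absv (X n - L))"
    using absv_diff[of "X n - c" "X n - L"] by simp
  also have "\<dots> \<le> B + e"
    using assms(2)[of n] M[of n] absv_nonneg[of "X n - c"] \<open>e > 0\<close> by (simp add: n_def del: absv_nonneg)
  finally show "absv (L - c) \<le> B + e" .
qed

lemma conv_absv_unique:
  assumes "conv_absv absv X L" "conv_absv absv X L'"
  shows "L = L'"
proof -
  have "absv (L - L') \<le> e" if "e > 0" for e
  proof -
    obtain N where "\<And>n. n \<ge> N \<Longrightarrow> absv (X n - L') < e"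
      using assms(2) \<open>e > 0\<close> by (auto simp: conv_absv_def)
    then show ?thesis using conv_absv_bound[OF assms(1), of N L' e] by fastforce
  qed
  then have "absv (L - L') \<le> 0" by (meson field_le_epsilon add_0 less_eq_real_def dense_ge)
  then show ?thesis using absv_nonneg[of "L - L'"] by (simp del: absv_nonneg)
qed

lemma conv_absv_add:
  assumes "conv_absv absv X L" "conv_absv absv Y M"
  shows "conv_absv absv (\<lambda>n. X n + Y n) (L + M)"
  unfolding conv_absv_def
proof (intro allI impI)
  fix e :: real assume "e > 0"
  then obtain N1 N2 where N: "\<And>n. n \<ge> N1 \<Longrightarrow> absv (X n - L) < e" "\<And>n. n \<ge> N2 \<Longrightarrow> absv (Y n - M) < e"
    using assms unfolding conv_absv_def by meson
  show "\<exists>N. \<forall>n\<ge>N. absv (X n + Y n - (L + M)) < e"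
  proof (intro exI allI impI)
    fix n assume "n \<ge> max N1 N2"
    then show "absv (X n + Y n - (L + M)) < e"
      using N[of n] absv_add[of "X n - L" "Y n - M"] by (simp add: algebra_simps)
  qed
qed

lemma conv_absv_cmult:
  assumes "conv_absv absv X L"
  shows "conv_absv absv (\<lambda>n. c * X n) (c * L)"
proof (cases "c = 0")
  case False
  show ?thesis unfolding conv_absv_def
  proof (intro allI impI)
    fix e :: real assume "e > 0"
    then have "e / absv c > 0" using False by (simp add: less_le)
    then obtain N where "\<And>n. n \<ge> N \<Longrightarrow> absv (X n - L) < e / absv c"
      using assms unfolding conv_absv_def by meson
    then show "\<exists>N. \<forall>n\<ge>N. absv (c * X n - c * L) < e"
      using \<open>e / absv c > 0\<close> \<open>e > 0\<close>
      by (auto simp: absv_mult pos_less_divide_eq zero_less_divide_iff mult.commute[of c]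
          simp flip: left_diff_distrib intro!: exI[of _ N])
  qed
qed (auto simp: conv_absv_def)

lemma poly_bounded:
  fixes p :: "'c poly"
  shows "\<exists>C\<ge>0. \<forall>x. absv x \<le> 1 \<longrightarrow> absv (poly p x) \<le> C"
proof (induction p)
  case (pCons a p)
  then obtain C where C: "C \<ge> 0" "\<And>x. absv x \<le> 1 \<Longrightarrow> absv (poly p x) \<le> C" by blast
  have "absv (poly (pCons a p) x) \<le> max (absv a) C" if "absv x \<le> 1" for x
    using absv_add[of a "x * poly p x"] mult_mono[OF that C(2)[OF that]] C
    by (auto simp: absv_mult)
  then show ?case using C(1) by (intro exI[of _ "max (absv a) C"]) auto
qed auto

text \<open>Supplies, with the same estimate for \<open>expo\<close>, the quadratic smallness at 0
  on which the uniqueness argument for the functional equation rests.\<close>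

lemma poly_linear_approx:
  fixes p :: "'c poly"
  assumes "coeff p 0 = 0"
  obtains C where "C \<ge> 0"
    "\<And>x. absv x \<le> 1 \<Longrightarrow> absv (poly p x - coeff p 1 * x) \<le> C * absv x ^ 2"
proof -
  obtain p' where p': "p = pCons 0 p'" using assms by (cases p) auto
  obtain b s where s: "p' = pCons b s" by (cases p') auto
  obtain C where C: "C \<ge> 0" "\<And>x. absv x \<le> 1 \<Longrightarrow> absv (poly s x) \<le> C"
    using poly_bounded[of s] by blast
  have "absv (poly p x - coeff p 1 * x) \<le> C * absv x ^ 2" if "absv x \<le> 1" for x
  proof -
    have "poly p x - coeff p 1 * x = poly s x * x ^ 2"
      by (simp add: p' s algebra_simps power2_eq_square)
    then show ?thesis using C(2)[OF that] by (simp add: absv_mult absv_power mult_right_mono)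
  qed
  with C(1) that show ?thesis by blast
qed

end

section \<open>Additivity, local behaviour and functional equation of the exponential\<close>

locale drinfeld_exp = drinfeld q ty \<theta> r \<kappa> + nonarch_field absv
  for q ty and \<theta> :: "'c::field" and r \<kappa> and absv :: "'c \<Rightarrow> real" +
  fixes expo :: "'c \<Rightarrow> 'c"
  assumes expo: "is_exp_rho q \<theta> absv r \<kappa> expo"
    and theta_gt_1: "absv \<theta> > 1"
begin

lemma theta_nonzero: "\<theta> \<noteq> 0"
  using theta_gt_1 by auto

lemma expo_theta: "expo (\<theta> * z) = rho (expo z)"
  using expo by (simp add: is_exp_rho_def)

text \<open>All exponents of the series are powers of \<open>q\<close>, so its partial sums are
  additive, and limits are unique.\<close>

lemma expo_add: "expo (x + y) = expo x + expo y"
proof -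
  obtain \<alpha> where \<alpha>: "\<And>z. sums_absv absv (\<lambda>i. \<alpha> i * z ^ q ^ i) (expo z)"
    using expo by (auto simp: is_exp_rho_def)
  have "conv_absv absv (\<lambda>n. \<Sum>i<n. \<alpha> i * (x + y) ^ q ^ i) (expo x + expo y)"
    using conv_absv_add[OF \<alpha>[of x, unfolded sums_absv_def] \<alpha>[of y, unfolded sums_absv_def]]
    by (simp add: frob_power_add distrib_left sum.distrib)
  with \<alpha>[of "x + y"] show ?thesis
    unfolding sums_absv_def using conv_absv_unique by blast
qed

lemma expo_0 [simp]: "expo 0 = 0"
  using expo_add[of 0 0] by (metis add_cancel_right_left add_0)

lemma expo_minus: "expo (- x) = - expo x"
  using expo_add[of x "- x"] by (simp add: eq_neg_iff_add_eq_0 add.commute)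

lemma expo_diff: "expo (x - y) = expo x - expo y"
  using expo_add[of x "- y"] by (simp add: expo_minus)

lemma expo_sum: "expo (sum f A) = (\<Sum>x\<in>A. expo (f x))"
  by (induction A rule: infinite_finite_induct) (simp_all add: expo_add)

lemma expo_Fq:
  assumes "c \<in> Fq q"
  shows "expo (c * z) = c * expo z"
proof -
  have c: "c ^ q ^ i = c" for i
    using assms by (induction i) (simp_all add: Fq_def power_mult)
  obtain \<alpha> where \<alpha>: "\<And>z. sums_absv absv (\<lambda>i. \<alpha> i * z ^ q ^ i) (expo z)"
    using expo by (auto simp: is_exp_rho_def)
  have "conv_absv absv (\<lambda>n. \<Sum>i<n. \<alpha> i * (c * z) ^ q ^ i) (c * expo z)"
    using conv_absv_cmult[OF \<alpha>[of z, unfolded sums_absv_def], of c]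
    by (simp add: power_mult_distrib c sum_distrib_left mult.left_commute)
  with \<alpha>[of "c * z"] show ?thesis
    unfolding sums_absv_def using conv_absv_unique by blast
qed

text \<open>Convergence at \<open>z = 1\<close> bounds the coefficients, and every term after the
  first has exponent \<open>q ^ i\<close> at least 2.\<close>

lemma expo_linear_approx:
  obtains C where "C \<ge> 0" "\<And>z. absv z \<le> 1 \<Longrightarrow> absv (expo z - z) \<le> C * absv z ^ 2"
proof -
  obtain \<alpha> where \<alpha>0: "\<alpha> 0 = 1" and \<alpha>: "\<And>z. sums_absv absv (\<lambda>i. \<alpha> i * z ^ q ^ i) (expo z)"
    using expo by (auto simp: is_exp_rho_def)
  obtain N where N: "\<And>n. n \<ge> N \<Longrightarrow> absv ((\<Sum>i<n. \<alpha> i) - expo 1) < 1"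
    using \<alpha>[of 1] unfolding sums_absv_def conv_absv_def by (metis (lifting) mult.right_neutral power_one sum.cong zero_less_one)
  \<comment> \<open>Coefficients with index below \<open>N\<close> are bounded by the sum; later
    ones are differences of two errors of size less than 1, which the summand 1 covers.\<close>
  define C where "C = 1 + (\<Sum>i<N. absv (\<alpha> i))"
  have C1: "C \<ge> 1" by (simp add: C_def sum_nonneg)
  have C: "absv (\<alpha> n) \<le> C" for n
  proof (cases "n < N")
    case True
    then have "absv (\<alpha> n) \<le> (\<Sum>i<N. absv (\<alpha> i))"
      by (intro member_le_sum) auto
    then show ?thesis by (simp add: C_def)
  next
    case False
    have "absv (\<alpha> n) \<le> max (absv ((\<Sum>i<Suc n. \<alpha> i) - expo 1)) (absv ((\<Sum>i<n. \<alpha> i) - expo 1))"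
      using absv_diff[of "(\<Sum>i<Suc n. \<alpha> i) - expo 1" "(\<Sum>i<n. \<alpha> i) - expo 1"] by simp
    also have "\<dots> \<le> 1" using N[of n] N[of "Suc n"] False by simp
    finally show ?thesis using C1 by simp
  qed
  have "absv (expo z - z) \<le> C * absv z ^ 2" if z: "absv z \<le> 1" for z
  proof (rule conv_absv_bound[OF \<alpha>[of z, unfolded sums_absv_def]])
    fix n :: nat assume "n \<ge> 1"
    then have "(\<Sum>i<n. \<alpha> i * z ^ q ^ i) - z = (\<Sum>i\<in>{1..<n}. \<alpha> i * z ^ q ^ i)"
      using \<alpha>0 by (simp add: lessThan_atLeast0 sum.atLeast_Suc_lessThan)
    also have "absv \<dots> \<le> C * absv z ^ 2"
    proof (rule absv_sum_le)
      fix i assume "i \<in> {1..<n}"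
      then have "2 \<le> q ^ i" using q_ge_2 self_le_power[of q i] by simp
      then have "absv z ^ q ^ i \<le> absv z ^ 2" using z by (intro power_decreasing) auto
      then show "absv (\<alpha> i * z ^ q ^ i) \<le> C * absv z ^ 2"
        using C[of i] C1 by (auto simp: absv_mult absv_power intro!: mult_mono)
    qed (use C1 in simp)
    finally show "absv ((\<Sum>i<n. \<alpha> i * z ^ q ^ i) - z) \<le> C * absv z ^ 2" .
  qed
  with C1 that show ?thesis by (meson dual_order.trans zero_le_one)
qed

lemma coeff_rho_poly_1: "coeff rho_poly 1 = \<theta>"
proof -
  have "q ^ i \<noteq> Suc 0" if "i \<ge> 1" for i
    using that q_ge_2 self_le_power[of q i] by auto
  then show ?thesis using r_pos by (simp add: rho_poly_def coeff_sum)
qed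

text \<open>Near 0 the linear term of \<open>rho\<close> dominates, since the quadratic error is at
  most |x| there and |\<theta>| > 1.\<close>

lemma rho_small:
  obtains \<epsilon> where "\<epsilon> > 0" "\<And>x. absv x \<le> \<epsilon> \<Longrightarrow> absv (rho x) \<le> absv \<theta> * absv x"
proof -
  obtain C where C: "C \<ge> 0"
    "\<And>x. absv x \<le> 1 \<Longrightarrow> absv (rho x - \<theta> * x) \<le> C * absv x ^ 2"
    using poly_linear_approx[OF coeff_rho_poly_0] coeff_rho_poly_1 by auto
  \<comment> \<open>The radius \<open>1 / (C + 1)\<close> in place of \<open>1 / C\<close> allows
    \<open>C = 0\<close>.\<close>
  have "absv (rho x) \<le> absv \<theta> * absv x" if x: "absv x \<le> min 1 (1 / (C + 1))" for x
  proof -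
    have "C * absv x \<le> (C + 1) * (1 / (C + 1))"
      using x C(1) by (intro mult_mono) auto
    also have "\<dots> = 1" using C(1) by simp
    finally have "C * absv x ^ 2 \<le> 1 * absv x"
      unfolding power2_eq_square mult.assoc[symmetric] by (rule mult_right_mono) simp
    also have "\<dots> \<le> absv \<theta> * absv x"
      using theta_gt_1 by (intro mult_right_mono) auto
    finally have "absv (rho x - \<theta> * x) \<le> absv \<theta> * absv x"
      using C(2)[of x] x by simp
    then show ?thesis
      using absv_add[of "rho x - \<theta> * x" "\<theta> * x"] by (simp add: absv_mult)
  qed
  moreover have "min 1 (1 / (C + 1)) > 0" using C(1) by simp
  ultimately show ?thesis using that by blast
qed

text \<open>Writing \<open>h z = \<rho>\<^sup>n (h (z / \<theta>\<^sup>n))\<close>, the quadratic decay beats the factor \<open>|\<theta>|\<^sup>n\<close>.\<close>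
lemma functional_equation_zero:
  assumes h: "\<And>z. h (\<theta> * z) = rho (h z)"
    and small: "\<delta> > 0" "C \<ge> 0" "\<And>z. absv z \<le> \<delta> \<Longrightarrow> absv (h z) \<le> C * absv z ^ 2"
  shows "h z = 0"
proof (rule ccontr)
  assume "h z \<noteq> 0"
  then have pos: "absv (h z) > 0" using absv_nonneg[of "h z"] by (simp add: less_le)
  obtain \<epsilon> where \<epsilon>: "\<epsilon> > 0" "\<And>x. absv x \<le> \<epsilon> \<Longrightarrow> absv (rho x) \<le> absv \<theta> * absv x"
    by (rule rho_small) blast
  define T where "T = absv \<theta>"
  have T: "T > 1" using theta_gt_1 by (simp add: T_def)
  define D where "D = C * absv z ^ 2"
  have D: "D \<ge> 0" using small by (simp add: D_def)
  \<comment> \<open>One \<open>n\<close> serves three ends: \<open>z / \<theta> ^ n\<close> lies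
    where \<open>h\<close> is quadratically small, the iterates stay where \<open>rho_small\<close>
    applies, and the final bound \<open>D / T ^ n\<close> is below
    \<open>absv (h z)\<close>.\<close>
  obtain n where n: "absv z / \<delta> + D / \<epsilon> + D / absv (h z) < T ^ n"
    using real_arch_pow[OF T] by blast
  have Tn: "T ^ n > 0" using T by simp
  have nonneg: "absv z / \<delta> \<ge> 0" "D / \<epsilon> \<ge> 0" "D / absv (h z) \<ge> 0"
    using D \<epsilon> small pos by auto
  have n1: "absv z / T ^ n \<le> \<delta>" and n2: "D / T ^ n \<le> \<epsilon>" and n3: "D / T ^ n < absv (h z)"
  proof -
    have "absv z / \<delta> < T ^ n" "D / \<epsilon> < T ^ n" "D / absv (h z) < T ^ n"
      using n nonneg by linarith+
    then show "absv z / T ^ n \<le> \<delta>" "D / T ^ n \<le> \<epsilon>" "D / T ^ n < absv (h z)"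
      using small(1) \<epsilon>(1) pos Tn by (simp_all add: field_simps)
  qed
  \<comment> \<open>Dividing \<open>z\<close> by \<open>\<theta> ^ n\<close> gains a factor
    \<open>T ^ (2 * n)\<close> in the quadratic bound; the \<open>n\<close> applications of
    \<open>rho\<close> that lead back to \<open>z\<close> lose only \<open>T ^ n\<close>.\<close>
  have "absv (h (\<theta> ^ k * (z / \<theta> ^ n))) \<le> T ^ k * (D / T ^ (2 * n))" if "k \<le> n" for k
    using that
  proof (induction k)
    case 0
    have "absv (z / \<theta> ^ n) * T ^ n = absv z"
      using theta_nonzero unfolding T_def by (simp flip: absv_mult absv_power)
    then have "absv (z / \<theta> ^ n) = absv z / T ^ n"
      using Tn by (metis less_irrefl nonzero_eq_divide_eq)
    moreover have "C * (absv z / T ^ n) ^ 2 = D / T ^ (2 * n)"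
      by (simp add: D_def power_divide power_even_eq)
    ultimately show ?case using small(3)[of "z / \<theta> ^ n"] n1 by simp
  next
    case (Suc k)
    let ?x = "h (\<theta> ^ k * (z / \<theta> ^ n))"
    have IH: "absv ?x \<le> T ^ k * (D / T ^ (2 * n))" using Suc by simp
    also have "\<dots> \<le> T ^ n * (D / T ^ (2 * n))"
      using T D Suc.prems by (intro mult_right_mono power_increasing) auto
    also have "\<dots> = D / T ^ n"
      using Tn by (simp add: mult_2 power_add)
    finally have "absv (rho ?x) \<le> T * absv ?x"
      using n2 \<epsilon>(2) by (simp add: T_def)
    also have "\<dots> \<le> T * (T ^ k * (D / T ^ (2 * n)))"
      using IH T by (intro mult_left_mono) auto
    finally show ?case using h[of "\<theta> ^ k * (z / \<theta> ^ n)"] by (simp add: mult.assoc)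
  qed
  from this[of n] have "absv (h z) \<le> D / T ^ n"
    using Tn T theta_nonzero by (simp add: mult_2 power_add)
  with n3 show False by simp
qed

text \<open>The difference of the two sides satisfies the functional equation of
  \<open>expo\<close>, because \<open>P\<close> commutes with \<open>rho\<close>. Both sides have
  the same linear term, so the difference is quadratically small at 0 and hence vanishes.\<close>

lemma poly_expo:
  assumes P0: "coeff P 0 = 0" and comm: "\<And>x. rho (poly P x) = poly P (rho x)"
  shows "poly P (expo z) = expo (coeff P 1 * z)"
proof -
  define b where "b = coeff P 1"
  define h where "h z = poly P (expo z) - expo (b * z)" for z
  obtain C where C: "C \<ge> 0" "\<And>z. absv z \<le> 1 \<Longrightarrow> absv (expo z - z) \<le> C * absv z ^ 2"
    by (rule expo_linear_approx) blast
  obtain C' where C': "C' \<ge> 0" "\<And>x. absv x \<le> 1 \<Longrightarrow> absv (poly P x - b * x) \<le> C' * absv x ^ 2"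
    unfolding b_def by (rule poly_linear_approx[OF P0]) blast
  define B where "B = absv b"
  have B: "B \<ge> 0" by (simp add: B_def)
  \<comment> \<open>Inside this radius \<open>expo z\<close> is no larger than \<open>z\<close> and
    \<open>b * z\<close> stays in the unit ball, so the estimates for \<open>P\<close> at
    \<open>expo z\<close> and for \<open>expo\<close> at \<open>z\<close> and \<open>b * z\<close>
    all apply.\<close>
  define \<delta> where "\<delta> = min 1 (min (1 / (C + 1)) (1 / (B + 1)))"
  have \<delta>: "\<delta> > 0" using C B by (simp add: \<delta>_def)
  define M where "M = C' + B * C + C * B ^ 2"
  have M: "M \<ge> 0" using C C' B by (simp add: M_def)
  have "absv (h z) \<le> M * absv z ^ 2" if z: "absv z \<le> \<delta>" for z
  proof -
    have z1: "absv z \<le> 1" using z by (simp add: \<delta>_def)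
    have "C * absv z \<le> (C + 1) * (1 / (C + 1))"
      using z C(1) by (intro mult_mono) (auto simp: \<delta>_def)
    also have "\<dots> = 1" using C(1) by simp
    finally have "C * absv z ^ 2 \<le> 1 * absv z"
      unfolding power2_eq_square mult.assoc[symmetric] by (rule mult_right_mono) simp
    then have e: "absv (expo z) \<le> absv z"
      using C(2)[OF z1] absv_add[of "expo z - z" z] by simp
    have "B * absv z \<le> (B + 1) * (1 / (B + 1))"
      using z B by (intro mult_mono) (auto simp: \<delta>_def)
    also have "\<dots> = 1" using B by simp
    finally have bz: "absv (b * z) \<le> 1" by (simp add: absv_mult B_def)
    have 1: "absv (poly P (expo z) - b * expo z) \<le> C' * absv z ^ 2"
      using C'(2)[of "expo z"] e z1 power_mono[OF e absv_nonneg, of 2] C'(1)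
      by (meson mult_left_mono order_trans)
    have 2: "absv (b * (expo z - z)) \<le> B * C * absv z ^ 2"
      using C(2)[OF z1] B by (simp add: absv_mult B_def mult.assoc mult_left_mono)
    have 3: "absv (expo (b * z) - b * z) \<le> C * B ^ 2 * absv z ^ 2"
      using C(2)[OF bz] by (simp add: absv_mult B_def power_mult_distrib mult.assoc)
    have "h z = (poly P (expo z) - b * expo z) + (b * (expo z - z) - (expo (b * z) - b * z))"
      by (simp add: h_def algebra_simps)
    then have "absv (h z) \<le> max (C' * absv z ^ 2) (max (B * C * absv z ^ 2) (C * B ^ 2 * absv z ^ 2))"
      using 1 2 3 absv_add[of "poly P (expo z) - b * expo z" "b * (expo z - z) - (expo (b * z) - b * z)"]
        absv_diff[of "b * (expo z - z)" "expo (b * z) - b * z"]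
      by (simp only:)
    also have "\<dots> \<le> M * absv z ^ 2"
      using C(1) C'(1) B by (simp add: M_def algebra_simps)
    finally show ?thesis .
  qed
  moreover have "h (\<theta> * z) = rho (h z)" for z
  proof -
    have "rho (x - y) = rho x - rho y" for x y
      using rho_add[of "x - y" y] by (simp add: eq_diff_eq)
    then show ?thesis
      using comm expo_theta[of z] expo_theta[of "b * z"] by (simp add: h_def mult.left_commute)
  qed
  ultimately have "h z = 0" using functional_equation_zero[of h \<delta> M z] \<delta> M by blast
  then show ?thesis by (simp add: h_def b_def)
qed

text \<open>A zero in the unit ball satisfies |z| \<le> C |z|^2, which rules out small nonzero
  ones.\<close>

lemma expo_nonzero_small:
  obtains \<delta> where "\<delta> > 0" "\<And>z. absv z < \<delta> \<Longrightarrow> expo z = 0 \<Longrightarrow> z = 0"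
proof -
  obtain C where C: "C \<ge> 0" "\<And>z. absv z \<le> 1 \<Longrightarrow> absv (expo z - z) \<le> C * absv z ^ 2"
    by (rule expo_linear_approx) blast
  have "z = 0" if z: "absv z < min 1 (1 / (C + 1))" and "expo z = 0" for z
  proof (rule ccontr)
    assume "z \<noteq> 0"
    then have pos: "absv z > 0" using absv_nonneg[of z] by (simp add: less_le)
    have "absv z \<le> C * absv z * absv z"
      using C(2)[of z] z \<open>expo z = 0\<close> by (simp add: power2_eq_square)
    then have "1 \<le> C * absv z" using pos by simp
    moreover have "(C + 1) * absv z < 1" using z C(1) by (simp add: field_simps)
    ultimately show False using pos by (simp add: algebra_simps)
  qed
  moreover have "min 1 (1 / (C + 1)) > 0" using C(1) by simp
  ultimately show ?thesis using that by blast
qed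

text \<open>\<open>expo\<close> is injective on high negative powers of \<theta>: by additivity two
  equal values give a zero in the small ball, so the arguments agree, and these powers have distinct
  absolute values.\<close>

lemma infinite_range_expo: "infinite (range expo)"
proof -
  obtain \<delta> where \<delta>: "\<delta> > 0" "\<And>z. absv z < \<delta> \<Longrightarrow> expo z = 0 \<Longrightarrow> z = 0"
    by (rule expo_nonzero_small) blast
  obtain N where N: "1 / \<delta> < absv \<theta> ^ N"
    using real_arch_pow[OF theta_gt_1] by blast
  define f where "f n = 1 / \<theta> ^ (N + n)" for n
  have absf: "absv (f n) = 1 / absv \<theta> ^ (N + n)" for n
  proof -
    have "absv (f n) * absv \<theta> ^ (N + n) = 1"
      using theta_nonzero by (simp add: f_def flip: absv_mult absv_power)
    moreover have "absv \<theta> ^ (N + n) > 0" using theta_gt_1 by simp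
    ultimately show ?thesis by (metis less_irrefl nonzero_eq_divide_eq)
  qed
  have small: "absv (f n) < \<delta>" for n
  proof -
    have "1 / \<delta> < absv \<theta> ^ (N + n)"
      using N power_increasing[of N "N + n" "absv \<theta>"] theta_gt_1 by linarith
    moreover have "absv \<theta> ^ (N + n) > 0" using theta_gt_1 by simp
    ultimately show ?thesis unfolding absf
      by (metis \<delta>(1) divide_less_eq mult.commute)
  qed
  have "inj (\<lambda>n. expo (f n))"
  proof (rule injI)
    fix m n assume "expo (f m) = expo (f n)"
    then have "expo (f m - f n) = 0" by (simp add: expo_diff)
    moreover have "absv (f m - f n) < \<delta>"
      using absv_diff[of "f m" "f n"] small[of m] small[of n] by linarith
    ultimately have "f m - f n = 0" by (rule \<delta>(2)[rotated])
    then have "absv (f m) = absv (f n)" by simp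
    then have "absv \<theta> ^ (N + m) = absv \<theta> ^ (N + n)" by (simp add: absf)
    then have "N + m = N + n" using theta_gt_1 power_inject_exp by blast
    then show "m = n" by simp
  qed
  then have "infinite (range (\<lambda>n. expo (f n)))" by (rule range_inj_infinite)
  then show ?thesis by (rule infinite_super[rotated]) auto
qed

text \<open>Otherwise \<open>poly_expo\<close> makes \<open>P\<close> vanish on the whole range of
  \<open>expo\<close>, which is infinite.\<close>

lemma coeff_1_nonzero:
  assumes "coeff P 0 = 0" "\<And>x. rho (poly P x) = poly P (rho x)" "P \<noteq> 0"
  shows "coeff P 1 \<noteq> 0"
proof
  assume "coeff P 1 = 0"
  then have "range expo \<subseteq> {x. poly P x = 0}"
    using poly_expo[OF assms(1,2)] by auto
  with poly_roots_finite[OF assms(3)] infinite_range_expo show False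
    using finite_subset by blast
qed

end


section \<open>Clearing denominators\<close>

context perfect_frobenius
begin

section \<open>Twists of rational functions\<close>

abbreviation trat :: "'c poly fract \<Rightarrow> 'c poly fract" where
  "trat \<equiv> twist_rat q (-1)"

text \<open>\<open>twist_rat\<close> chooses a representative of the fraction; twisting preserves
  the cross-multiplied equation, so the choice does not matter.\<close>

lemma trat_Fract:
  assumes "b \<noteq> 0"
  shows "trat (Fract a b) = Fract (utw a) (utw b)"
proof -
  define ab where "ab = (SOME ab. snd ab \<noteq> 0 \<and> Fract a b = Fract (fst ab) (snd ab))"
  have "\<exists>ab. snd ab \<noteq> 0 \<and> Fract a b = Fract (fst ab) (snd ab)"
    using assms by (intro exI[of _ "(a, b)"]) simp
  from someI_ex[OF this] have ab: "snd ab \<noteq> 0" "Fract a b = Fract (fst ab) (snd ab)"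
    by (auto simp: ab_def)
  then have "a * snd ab = fst ab * b" using assms by (simp add: eq_fract)
  then have "utw a * utw (snd ab) = utw (fst ab) * utw b" by (simp flip: utw_mult)
  then show ?thesis
    using ab assms by (simp add: twist_rat_def Let_def eq_fract flip: ab_def)
qed

lemma trat_to_fract [simp]: "trat (to_fract a) = to_fract (utw a)"
  by (simp add: to_fract_def trat_Fract)

lemma trat_mult: "trat (x * y) = trat x * trat y"
proof (cases x; cases y)
  fix a b c d :: "'c poly"
  assume "x = Fract a b" "b \<noteq> 0" "y = Fract c d" "d \<noteq> 0"
  then show ?thesis by (simp add: trat_Fract)
qed

lemma range_to_fract_closed:
  "x \<in> range to_fract \<Longrightarrow> y \<in> range to_fract \<Longrightarrow> x + y \<in> range to_fract"
  "x \<in> range to_fract \<Longrightarrow> y \<in> range to_fract \<Longrightarrow> x - y \<in> range to_fract"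
  "x \<in> range to_fract \<Longrightarrow> y \<in> range to_fract \<Longrightarrow> x * y \<in> range to_fract"
  "to_fract a \<in> range to_fract"
  by (auto simp flip: to_fract_add to_fract_diff to_fract_mult)

lemma range_to_fract_scale:
  "to_fract b * x \<in> range to_fract \<Longrightarrow> to_fract a * (to_fract b * x) \<in> range to_fract"
  using range_to_fract_closed(3,4) by blast

lemma range_to_fract_sum:
  "(\<And>i. i \<in> A \<Longrightarrow> f i \<in> range to_fract) \<Longrightarrow> sum f A \<in> range to_fract"
  by (induction A rule: infinite_finite_induct)
    (auto intro: range_to_fract_closed simp flip: to_fract_0)

lemma to_fract_twist_cancel:
  assumes "to_fract e * trat x \<in> range to_fract"
  shows "to_fract (tw 1 e) * x \<in> range to_fract"
proof (cases x)
  case (Fract a b)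
  obtain c where "to_fract e * trat x = to_fract c" using assms by auto
  then have "e * utw a = c * utw b"
    using Fract by (simp add: trat_Fract to_fract_def eq_fract)
  then have "tw 1 (e * utw a) = tw 1 (c * utw b)" by simp
  then have "tw 1 e * a = tw 1 c * b" using tw_Suc_utw[of 0] by simp
  then have "to_fract (tw 1 e) * x = to_fract (tw 1 c)"
    using Fract by (simp add: to_fract_def eq_fract)
  then show ?thesis by simp
qed

section \<open>Common denominators and their invariance under twisting\<close>

lemma finite_common_denominator:
  fixes S :: "'c poly fract set"
  assumes "finite S"
  shows "\<exists>d. d \<noteq> 0 \<and> (\<forall>x\<in>S. to_fract d * x \<in> range to_fract)"
  using assms
proof induction
  case (insert x S)
  then obtain d where d: "d \<noteq> 0" "\<forall>x\<in>S. to_fract d * x \<in> range to_fract" by blast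
  obtain a b where ab: "x = Fract a b" "b \<noteq> 0" by (cases x)
  have "to_fract b * x = to_fract a"
    using ab by (simp add: to_fract_def eq_fract)
  then have "to_fract (d * b) * x \<in> range to_fract"
    by (metis mult.assoc rangeI to_fract_mult)
  moreover have "to_fract (d * b) * y \<in> range to_fract" if "y \<in> S" for y
  proof -
    have "to_fract b * (to_fract d * y) \<in> range to_fract"
      using d(2) that by (intro range_to_fract_scale) simp
    then show ?thesis by (simp add: mult_ac)
  qed
  ultimately show ?case using d(1) ab(2) by (intro exI[of _ "d * b"]) auto
qed (auto intro: exI[of _ 1])

text \<open>The polynomials clearing \<open>S\<close> form an ideal, and a nonzero element of least
  degree generates it by division with remainder. A monic generator later turns equality up to a
  unit into equality.\<close>

lemma principal_denominator:
  fixes S :: "'c poly fract set"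
  assumes "finite S"
  obtains D where "lead_coeff D = 1" "\<And>x. x \<in> S \<Longrightarrow> to_fract D * x \<in> range to_fract"
    "\<And>d. (\<And>x. x \<in> S \<Longrightarrow> to_fract d * x \<in> range to_fract) \<Longrightarrow> D dvd d"
proof -
  define I where "I d \<longleftrightarrow> (\<forall>x\<in>S. to_fract d * x \<in> range to_fract)" for d
  obtain D where D: "D \<noteq> 0" "I D" and min: "\<And>d. d \<noteq> 0 \<Longrightarrow> I d \<Longrightarrow> degree D \<le> degree d"
    using ex_has_least_nat[of "\<lambda>d. d \<noteq> 0 \<and> I d" _ degree] finite_common_denominator[OF assms]
    unfolding I_def by metis
  have I_mult: "I (e * d)" if "I d" for d e
    unfolding I_def
  proof
    fix x assume "x \<in> S"
    with that have "to_fract e * (to_fract d * x) \<in> range to_fract"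
      by (intro range_to_fract_scale) (simp add: I_def)
    then show "to_fract (e * d) * x \<in> range to_fract" by (simp add: mult.assoc)
  qed
  have "D dvd d" if "I d" for d
  proof (rule ccontr)
    assume "\<not> D dvd d"
    then have "d mod D \<noteq> 0" by (simp add: dvd_eq_mod_eq_0)
    moreover have "I (d mod D)"
    proof -
      have "to_fract (d - d div D * D) * x \<in> range to_fract" if "x \<in> S" for x
        using that \<open>I d\<close> I_mult[OF D(2), of "d div D"]
        unfolding to_fract_diff left_diff_distrib I_def
        by (intro range_to_fract_closed(2)) auto
      then show ?thesis by (simp add: I_def minus_div_mult_eq_mod)
    qed
    ultimately show False
      using min[of "d mod D"] degree_mod_less'[of D d] D(1) by fastforce
  qed
  moreover define D' where "D' = smult (inverse (lead_coeff D)) D"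
  moreover have "I D'"
    using I_mult[OF D(2), of "[:inverse (lead_coeff D):]"] by (simp add: D'_def)
  moreover have "lead_coeff D' = 1" using D(1) by (simp add: D'_def)
  ultimately show ?thesis using that[of D'] D(1) by (simp add: I_def smult_dvd_iff)
qed

text \<open>If \<open>D\<close> vanished at \<theta>, the first divisibility would pass the root on
  to all \<open>q ^ n\<close>-th roots of \<theta>, infinitely many by aperiodicity. So
  \<open>tw 1 D\<close> does not vanish at \<open>\<theta> ^ q\<close>, and the linear factor in the
  second divisibility must divide the cofactor. Cancelling it gives \<open>tw 1 D dvd D\<close>, and
  both are monic of the same degree.\<close>

lemma twist_invariant_if_dvd:
  assumes monic: "lead_coeff D = 1"
    and dvd1: "D dvd tw 1 D * [:- (\<theta> ^ q), 1:]" and dvd2: "tw 1 D dvd D * [:- (\<theta> ^ q), 1:]"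
    and aperiodic: "\<And>n. n \<ge> 1 \<Longrightarrow> \<theta> ^ q ^ n \<noteq> \<theta>"
  shows "tw 1 D = D"
proof -
  have D0: "D \<noteq> 0" using monic by auto
  have "poly D \<theta> \<noteq> 0"
  proof
    assume root: "poly D \<theta> = 0"
    define y where "y n = (untw ^^ n) \<theta>" for n
    have y: "y n ^ q ^ n = \<theta>" for n
      by (induction n) (simp_all add: y_def power_mult)
    have "poly D (y n) = 0" for n
    proof (induction n)
      case (Suc n)
      then have "poly (tw 1 D * [:- (\<theta> ^ q), 1:]) (y n) = 0"
        using dvd1 by (metis dvdE mult_zero_left poly_mult)
      \<comment> \<open>Equality would give \<open>\<theta> ^ q ^ Suc n = \<theta>\<close> after
        taking \<open>q ^ n\<close>-th powers.\<close>
      moreover have "y n \<noteq> \<theta> ^ q"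
        using y[of n] aperiodic[of "Suc n"] by (auto simp: power_mult)
      ultimately have "poly (tw 1 D) (y n) = 0" unfolding poly_mult by simp
      moreover have "y n = y (Suc n) ^ q ^ 1" by (simp add: y_def)
      ultimately show ?case using poly_tw[of 1 D "y (Suc n)"] by simp
    qed (simp add: root y_def)
    then have "range y \<subseteq> {x. poly D x = 0}" by auto
    moreover have "inj y"
    proof -
      have "y m \<noteq> y n" if "m < n" for m n
      proof
        assume "y m = y n"
        then have "y m ^ q ^ (m + (n - m)) = \<theta>" using y[of n] that by simp
        then have "(y m ^ q ^ m) ^ q ^ (n - m) = \<theta>" by (simp add: power_add power_mult)
        then show False using aperiodic[of "n - m"] that y by simp
      qed
      then show ?thesis by (intro injI) (metis linorder_neqE_nat)
    qed
    ultimately show False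
      using poly_roots_finite[OF D0] range_inj_infinite finite_subset by blast
  qed
  then have "poly (tw 1 D) (\<theta> ^ q) \<noteq> 0" using poly_tw[of 1 D \<theta>] by simp
  moreover obtain X where X: "D * [:- (\<theta> ^ q), 1:] = tw 1 D * X" using dvd2 by (auto elim: dvdE)
  have "poly (tw 1 D) (\<theta> ^ q) * poly X (\<theta> ^ q) = poly (D * [:- (\<theta> ^ q), 1:]) (\<theta> ^ q)"
    by (simp only: X poly_mult)
  then have "poly (tw 1 D) (\<theta> ^ q) * poly X (\<theta> ^ q) = 0" unfolding poly_mult by simp
  ultimately have "poly X (\<theta> ^ q) = 0" by simp
  then obtain Y where "X = [:- (\<theta> ^ q), 1:] * Y" by (auto simp: poly_eq_0_iff_dvd elim: dvdE)
  with X have "[:- (\<theta> ^ q), 1:] * D = [:- (\<theta> ^ q), 1:] * (tw 1 D * Y)"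
    by (metis mult.commute mult.left_commute)
  then have DY: "D = tw 1 D * Y" by (subst (asm) mult_left_cancel) auto
  then have "Y \<noteq> 0" using D0 by auto
  have "degree D = degree D + degree Y"
    using degree_mult_eq[of "tw 1 D" Y] \<open>Y \<noteq> 0\<close> D0 DY by simp
  then obtain c where "Y = [:c:]" by (auto elim: degree_eq_zeroE)
  moreover have "lead_coeff D = lead_coeff (tw 1 D) * lead_coeff Y"
    using DY lead_coeff_mult by metis
  then have "lead_coeff Y = 1" using monic by simp
  ultimately show ?thesis using DY by (simp add: one_pCons flip: one_pCons)
qed

end

context drinfeld
begin

section \<open>The action of sigma on rational rows\<close>

abbreviation "tmt \<equiv> [:- \<theta>, 1:]"

definition sig_rat :: "(nat \<Rightarrow> 'c poly fract) \<Rightarrow> nat \<Rightarrow> 'c poly fract" where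
  "sig_rat f l = (\<Sum>m<r. trat (f m) * Phi_rho q \<theta> r \<kappa> m l)"

lemma Phi_last_0: "Phi_rho q \<theta> r \<kappa> (r - 1) 0 = to_fract tmt"
  and Phi_last: "l > 0 \<Longrightarrow> Phi_rho q \<theta> r \<kappa> (r - 1) l = - to_fract [:kap l:]"
  by (simp_all add: Phi_rho_def t_rat_def const_rat_def kap_def to_fract_def)

lemma sig_rat_0: "sig_rat f 0 = to_fract tmt * trat (f (r - 1))"
proof -
  have "sig_rat f 0 = (\<Sum>m<r. if m = r - 1 then to_fract tmt * trat (f (r - 1)) else 0)"
    unfolding sig_rat_def
    by (intro sum.cong refl) (use Phi_last_0 in \<open>auto simp: Phi_rho_def\<close>)
  then show ?thesis using r_pos by simp
qed

lemma sig_rat_pos: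
  assumes "l > 0" "l < r"
  shows "sig_rat f l = trat (f (l - 1)) - to_fract [:kap l:] * trat (f (r - 1))"
proof -
  have "sig_rat f l = (\<Sum>m<r. (if m = l - 1 then trat (f (l - 1)) else 0)
      + (if m = r - 1 then - to_fract [:kap l:] * trat (f (r - 1)) else 0))"
    unfolding sig_rat_def
  proof (intro sum.cong refl)
    fix m assume "m \<in> {..<r}"
    show "trat (f m) * Phi_rho q \<theta> r \<kappa> m l = (if m = l - 1 then trat (f (l - 1)) else 0)
      + (if m = r - 1 then - to_fract [:kap l:] * trat (f (r - 1)) else 0)"
    proof (cases "m = r - 1")
      case True
      then show ?thesis using assms Phi_last[OF assms(1)] by auto
    next
      case False
      then show ?thesis using assms by (cases "l = Suc m") (auto simp: Phi_rho_def)
    qed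
  qed
  then show ?thesis using assms by (simp add: sum.distrib)
qed

lemma sig_rat_to_fract:
  assumes "\<And>l. l < r \<Longrightarrow> f l = to_fract (g l)" "l < r"
  shows "sig_rat f l = to_fract (sig g l)"
  using assms r_pos
  by (cases "l = 0") (simp_all add: sig_rat_0 sig_rat_pos sig_def flip: to_fract_mult to_fract_diff)

lemma sig_rat_mult:
  "sig_rat (\<lambda>l. to_fract d * f l) l = to_fract (utw d) * sig_rat f l"
  by (simp add: sig_rat_def trat_mult sum_distrib_left mult.assoc)

lemma sig_rat_integral:
  assumes "\<And>l. l < r \<Longrightarrow> to_fract d * f l \<in> range to_fract" "l < r"
  shows "to_fract (utw d) * sig_rat f l \<in> range to_fract"
proof -
  obtain g where "\<And>l. l < r \<Longrightarrow> to_fract d * f l = to_fract (g l)"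
    using assms(1) unfolding image_iff by metis
  then have "sig_rat (\<lambda>l. to_fract d * f l) l = to_fract (sig g l)"
    using assms(2) by (rule sig_rat_to_fract)
  then show ?thesis using assms(2) by (simp add: sig_rat_mult)
qed

text \<open>The matrix \<Phi> can be inverted at the cost of one factor \<open>tmt\<close>: column 0
  determines the last entry of the twisted row after this multiplication, and column
  \<open>l + 1\<close> then determines entry \<open>l\<close>.\<close>

lemma integral_of_sig_rat:
  assumes f: "\<And>l. l < r \<Longrightarrow> to_fract d * sig_rat f l \<in> range to_fract" and "l < r"
  shows "to_fract (d * tmt) * trat (f l) \<in> range to_fract"
proof -
  have last: "to_fract (d * tmt) * trat (f (r - 1)) \<in> range to_fract"
    using f[of 0] r_pos by (simp add: sig_rat_0 mult.assoc del: mult_pCons_right)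
  show ?thesis
  proof (cases "l = r - 1")
    case False
    with \<open>l < r\<close> have l: "Suc l < r" by simp
    have "to_fract tmt * (to_fract d * sig_rat f (Suc l))
        + to_fract [:kap (Suc l):] * (to_fract (d * tmt) * trat (f (r - 1))) \<in> range to_fract"
      using last f[OF l] by (intro range_to_fract_closed(1) range_to_fract_scale)
    also have "to_fract tmt * (to_fract d * sig_rat f (Suc l))
        + to_fract [:kap (Suc l):] * (to_fract (d * tmt) * trat (f (r - 1)))
        = to_fract (d * tmt) * trat (f l)"
      unfolding to_fract_mult sig_rat_pos[OF zero_less_Suc l] by (simp only: diff_Suc_1 algebra_simps)
    finally show ?thesis .
  qed (use last in simp)
qed

text \<open>Let \<open>D\<close> be the monic generator of the common denominators of \<gamma> and
  all \<open>E i\<close>. The equations show that \<open>D * tmt\<close> clears the twisted entries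
  and \<open>utw D * tmt\<close> the entries themselves; hence \<open>D\<close> is invariant under
  twisting, and multiplication by it commutes with \<open>sig_rat\<close>.\<close>

lemma clear_denominators:
  fixes E :: "nat \<Rightarrow> nat \<Rightarrow> nat \<Rightarrow> 'c poly fract"
  assumes aperiodic: "\<And>n. n \<ge> 1 \<Longrightarrow> \<theta> ^ q ^ n \<noteq> \<theta>"
    and row: "\<And>i m l. i < n \<Longrightarrow> Suc m < r \<Longrightarrow> l < r \<Longrightarrow> E i (Suc m) l = sig_rat (E i m) l"
    and last: "\<And>i l. i < n \<Longrightarrow> l < r \<Longrightarrow> to_fract tmt * E i 0 l =
      (\<Sum>m\<in>{1..<r}. to_fract [:kap m:] * E i m l) + sig_rat (E i (r - 1)) l"
    and triv: "\<And>l. l < r \<Longrightarrow> sig_rat \<gamma> l + (\<Sum>i<n. to_fract [:\<alpha> i:] * E i 0 l) = \<gamma> l"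
  obtains D M g where "D \<noteq> 0"
    "\<And>i m l. i < n \<Longrightarrow> m < r \<Longrightarrow> l < r \<Longrightarrow> to_fract D * E i m l = to_fract (M i m l)"
    "\<And>i m l. i < n \<Longrightarrow> Suc m < r \<Longrightarrow> l < r \<Longrightarrow> M i (Suc m) l = sig (M i m) l"
    "\<And>i l. i < n \<Longrightarrow> l < r \<Longrightarrow> tmt * M i 0 l =
      (\<Sum>m\<in>{1..<r}. smult (kap m) (M i m l)) + sig (M i (r - 1)) l"
    "\<And>l. l < r \<Longrightarrow> sig g l + (\<Sum>i<n. smult (\<alpha> i) (M i 0 l)) = g l"
proof -
  define S where "S = \<gamma> ` {..<r} \<union> (\<lambda>(i, m, l). E i m l) ` ({..<n} \<times> {..<r} \<times> {..<r})"
  have "finite S" by (simp add: S_def)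
  have S_\<gamma>: "\<gamma> l \<in> S" if "l < r" for l using that by (auto simp: S_def)
  have S_E: "E i m l \<in> S" if "i < n" "m < r" "l < r" for i m l
    using that by (force simp: S_def)
  have S_cases: "P x" if "x \<in> S" "\<And>l. l < r \<Longrightarrow> P (\<gamma> l)"
    "\<And>i m l. i < n \<Longrightarrow> m < r \<Longrightarrow> l < r \<Longrightarrow> P (E i m l)" for P x
    using that by (auto simp: S_def)
  define I where "I d \<longleftrightarrow> (\<forall>x\<in>S. to_fract d * x \<in> range to_fract)" for d
  obtain D where D: "lead_coeff D = 1" "I D" "\<And>d. I d \<Longrightarrow> D dvd d"
    using principal_denominator[OF \<open>finite S\<close>] unfolding I_def by metis
  have I_\<gamma>: "to_fract D * \<gamma> l \<in> range to_fract" if "l < r" for l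
    using D(2) S_\<gamma>[OF that] by (auto simp: I_def)
  have I_E: "to_fract D * E i m l \<in> range to_fract" if "i < n" "m < r" "l < r" for i m l
    using D(2) S_E[OF that] by (auto simp: I_def)

  \<comment> \<open>First divisibility: the equations express every \<open>sig_rat\<close> row
    through entries that \<open>D\<close> clears, and inverting \<Phi> costs
    \<open>tmt\<close>.\<close>
  have "to_fract (D * tmt) * trat x \<in> range to_fract" if "x \<in> S" for x
    using that
  proof (rule S_cases)
    fix l assume "l < r"
    show "to_fract (D * tmt) * trat (\<gamma> l) \<in> range to_fract"
    proof (rule integral_of_sig_rat[OF _ \<open>l < r\<close>])
      fix l assume l: "l < r"
      have "to_fract D * \<gamma> l - (\<Sum>i<n. to_fract [:\<alpha> i:] * (to_fract D * E i 0 l)) \<in> range to_fract"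
        using l r_pos I_\<gamma> I_E
        by (intro range_to_fract_closed(1,2) range_to_fract_sum range_to_fract_scale) auto
      also have "to_fract D * \<gamma> l - (\<Sum>i<n. to_fract [:\<alpha> i:] * (to_fract D * E i 0 l)) =
          to_fract D * sig_rat \<gamma> l"
        using triv[OF l, symmetric] by (simp add: algebra_simps sum_distrib_left)
      finally show "to_fract D * sig_rat \<gamma> l \<in> range to_fract" .
    qed
  next
    fix i m l assume i: "i < n" and m: "m < r" and "l < r"
    show "to_fract (D * tmt) * trat (E i m l) \<in> range to_fract"
    proof (rule integral_of_sig_rat[OF _ \<open>l < r\<close>])
      fix l assume l: "l < r"
      show "to_fract D * sig_rat (E i m) l \<in> range to_fract"
      proof (cases "Suc m < r")
        case True
        then show ?thesis using row[OF i True l] I_E[OF i True l] by simp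
      next
        case False
        then have m: "m = r - 1" using m by simp
        have "to_fract tmt * (to_fract D * E i 0 l)
            - (\<Sum>m\<in>{1..<r}. to_fract [:kap m:] * (to_fract D * E i m l)) \<in> range to_fract"
          using l r_pos i I_E by (intro range_to_fract_closed(1,2) range_to_fract_sum range_to_fract_scale) auto
        also have "to_fract tmt * (to_fract D * E i 0 l)
            - (\<Sum>m\<in>{1..<r}. to_fract [:kap m:] * (to_fract D * E i m l)) =
            to_fract D * (to_fract tmt * E i 0 l - (\<Sum>m\<in>{1..<r}. to_fract [:kap m:] * E i m l))"
          by (simp only: right_diff_distrib sum_distrib_left mult_ac)
        also have "\<dots> = to_fract D * sig_rat (E i m) l"
          unfolding last[OF i l] m by simp
        finally show ?thesis .
      qed
    qed
  qed
  then have "I (tw 1 (D * tmt))" unfolding I_def using to_fract_twist_cancel by blast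
  then have dvd1: "D dvd tw 1 D * [:- (\<theta> ^ q), 1:]"
    using D(3) frob_power_minus[of \<theta> 1] by (simp only: tw_mult tw_pCons) simp

  \<comment> \<open>Second divisibility: the rows from 1 on are \<open>sig_rat\<close> of the row
    before, so \<open>utw D\<close> clears them.\<close>
  have tail: "to_fract (utw D) * E i m l \<in> range to_fract" if "i < n" "1 \<le> m" "m < r" "l < r" for i m l
  proof -
    obtain m' where "m = Suc m'" using \<open>1 \<le> m\<close> by (cases m) auto
    then show ?thesis using that row sig_rat_integral[OF I_E] by simp
  qed
  \<comment> \<open>Row 0 has no predecessor; the equation \<open>last\<close> reaches it only with
    the factor \<open>tmt\<close>.\<close>
  have head: "to_fract (utw D) * (to_fract tmt * E i 0 l) \<in> range to_fract" if i: "i < n" and l: "l < r" for i l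
  proof -
    have "(\<Sum>m\<in>{1..<r}. to_fract [:kap m:] * (to_fract (utw D) * E i m l))
        + to_fract (utw D) * sig_rat (E i (r - 1)) l \<in> range to_fract"
      using tail r_pos i l
      by (intro range_to_fract_closed(1,2) range_to_fract_sum range_to_fract_scale sig_rat_integral I_E) auto
    also have "(\<Sum>m\<in>{1..<r}. to_fract [:kap m:] * (to_fract (utw D) * E i m l))
        + to_fract (utw D) * sig_rat (E i (r - 1)) l = to_fract (utw D) * (to_fract tmt * E i 0 l)"
      unfolding last[OF i l] by (simp only: distrib_left sum_distrib_left mult_ac)
    finally show ?thesis .
  qed
  have "to_fract (utw D * tmt) * x \<in> range to_fract" if "x \<in> S" for x
    using that
  proof (rule S_cases)
    fix l assume l: "l < r"
    have "to_fract tmt * (to_fract (utw D) * sig_rat \<gamma> l)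
        + (\<Sum>i<n. to_fract [:\<alpha> i:] * (to_fract (utw D) * (to_fract tmt * E i 0 l))) \<in> range to_fract"
      using l by (intro range_to_fract_closed(1) range_to_fract_sum
          range_to_fract_scale[OF head] range_to_fract_scale[OF sig_rat_integral] I_\<gamma>) auto
    also have "to_fract tmt * (to_fract (utw D) * sig_rat \<gamma> l)
        + (\<Sum>i<n. to_fract [:\<alpha> i:] * (to_fract (utw D) * (to_fract tmt * E i 0 l)))
        = to_fract (utw D * tmt) * (sig_rat \<gamma> l + (\<Sum>i<n. to_fract [:\<alpha> i:] * E i 0 l))"
      unfolding to_fract_mult by (simp only: distrib_left sum_distrib_left mult_ac)
    also have "\<dots> = to_fract (utw D * tmt) * \<gamma> l" using triv[OF l] by simp
    finally show "to_fract (utw D * tmt) * \<gamma> l \<in> range to_fract" .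
  next
    fix i m l assume "i < n" "m < r" "l < r"
    then show "to_fract (utw D * tmt) * E i m l \<in> range to_fract"
      using head[of i l] range_to_fract_scale[OF tail[of i m l], of tmt]
      by (cases "m = 0") (simp_all add: mult_ac del: mult_pCons_left mult_pCons_right)
  qed
  then have "D dvd utw D * tmt" using D(3) by (simp add: I_def)
  then have "tw 1 D dvd tw 1 (utw D * tmt)" by (metis dvdE dvdI tw_mult)
  then have dvd2: "tw 1 D dvd D * [:- (\<theta> ^ q), 1:]"
    using tw_Suc_utw[of 0 D] frob_power_minus[of \<theta> 1] by (simp only: tw_mult tw_pCons) simp

  have "tw 1 D = D" using D(1) dvd1 dvd2 aperiodic by (rule twist_invariant_if_dvd)
  \<comment> \<open>Invariance under \<open>utw\<close> lets \<open>D\<close> pass through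
    \<open>sig_rat\<close>, so the polynomial rows satisfy the same equations as the rational
    ones.\<close>
  then have utwD: "utw D = D" using utw_tw_Suc[of 0 D] by simp
  obtain M where M: "\<And>i m l. i < n \<Longrightarrow> m < r \<Longrightarrow> l < r \<Longrightarrow> to_fract D * E i m l = to_fract (M i m l)"
    using I_E unfolding image_iff by metis
  obtain g where g: "\<And>l. l < r \<Longrightarrow> to_fract D * \<gamma> l = to_fract (g l)"
    using I_\<gamma> unfolding image_iff by metis
  have sigM: "to_fract D * sig_rat (E i m) l = to_fract (sig (M i m) l)" if "i < n" "m < r" "l < r" for i m l
    using sig_rat_mult[of D "E i m" l] sig_rat_to_fract[of "\<lambda>l. to_fract D * E i m l" "M i m" l] M that
    by (simp add: utwD)
  show ?thesis
  proof (rule that)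
    show "D \<noteq> 0" using D(1) by auto
    show "to_fract D * E i m l = to_fract (M i m l)" if "i < n" "m < r" "l < r" for i m l
      using M that .
    show "M i (Suc m) l = sig (M i m) l" if "i < n" "Suc m < r" "l < r" for i m l
    proof -
      have "to_fract (M i (Suc m) l) = to_fract (sig (M i m) l)"
        using that by (simp add: row sigM flip: M)
      then show ?thesis by simp
    qed
    show "tmt * M i 0 l = (\<Sum>m\<in>{1..<r}. smult (kap m) (M i m l)) + sig (M i (r - 1)) l"
      if i: "i < n" and l: "l < r" for i l
    proof -
      have sum: "to_fract (\<Sum>m\<in>{1..<r}. [:kap m:] * M i m l) = (\<Sum>m\<in>{1..<r}. to_fract ([:kap m:] * M i m l))"
        by (rule sum_comp_morphism[of to_fract, unfolded o_def, symmetric]) simp_all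
      have "to_fract (tmt * M i 0 l) = to_fract D * (to_fract tmt * E i 0 l)"
        using M[OF i _ l, of 0] r_pos by (simp add: mult_ac del: mult_pCons_left mult_pCons_right)
      also have "\<dots> = (\<Sum>m\<in>{1..<r}. to_fract [:kap m:] * (to_fract D * E i m l)) + to_fract D * sig_rat (E i (r - 1)) l"
        unfolding last[OF i l] by (simp only: distrib_left sum_distrib_left mult_ac)
      also have "\<dots> = to_fract ((\<Sum>m\<in>{1..<r}. [:kap m:] * M i m l) + sig (M i (r - 1)) l)"
        unfolding to_fract_add sum using i l r_pos
        by (simp add: sigM M del: mult_pCons_left mult_pCons_right)
      finally show ?thesis unfolding to_fract_eq_iff by simp
    qed
    show "sig g l + (\<Sum>i<n. smult (\<alpha> i) (M i 0 l)) = g l" if l: "l < r" for l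
    proof -
      have sum: "to_fract (\<Sum>i<n. [:\<alpha> i:] * M i 0 l) = (\<Sum>i<n. to_fract ([:\<alpha> i:] * M i 0 l))"
        by (rule sum_comp_morphism[of to_fract, unfolded o_def, symmetric]) simp_all
      have "to_fract (g l) = to_fract D * \<gamma> l" using g[OF l] by simp
      also have "\<dots> = to_fract D * sig_rat \<gamma> l + (\<Sum>i<n. to_fract [:\<alpha> i:] * (to_fract D * E i 0 l))"
        unfolding triv[OF l, symmetric] by (simp only: distrib_left sum_distrib_left mult_ac)
      also have "to_fract D * sig_rat \<gamma> l = to_fract (sig g l)"
        using sig_rat_mult[of D \<gamma> l] sig_rat_to_fract[of "\<lambda>l. to_fract D * \<gamma> l" g l] g l
        by (simp add: utwD)
      also have "(\<Sum>i<n. to_fract [:\<alpha> i:] * (to_fract D * E i 0 l)) = to_fract (\<Sum>i<n. [:\<alpha> i:] * M i 0 l)"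
        unfolding sum using l r_pos by (simp add: M del: mult_pCons_left mult_pCons_right)
      finally show ?thesis unfolding to_fract_add[symmetric] to_fract_eq_iff by simp
    qed
  qed
qed

end


section \<open>Linear algebra over subfields\<close>

text \<open>The field type as a ring record with full carrier, which makes the dimension theory of
  embedded algebras available; subfields remain sets of elements.\<close>

definition field_ring :: "'c::field ring" where
  "field_ring = \<lparr>carrier = UNIV, monoid.mult = (*), one = 1, ring.zero = 0, add = (+)\<rparr>"

lemma field_ring_simps [simp]:
  "carrier field_ring = UNIV" "x \<otimes>\<^bsub>field_ring\<^esub> y = x * y" "x \<oplus>\<^bsub>field_ring\<^esub> y = x + y"
  "\<one>\<^bsub>field_ring\<^esub> = 1" "\<zero>\<^bsub>field_ring\<^esub> = 0"
  by (simp_all add: field_ring_def)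

interpretation FR: Ring.field "field_ring :: 'c::field ring"
proof (rule cring.cring_fieldI2)
  show "cring (field_ring :: 'c ring)"
  proof (intro cringI abelian_groupI comm_monoidI)
    fix x :: 'c
    show "\<exists>y\<in>carrier field_ring. y \<oplus>\<^bsub>field_ring\<^esub> x = \<zero>\<^bsub>field_ring\<^esub>"
      by (rule bexI[of _ "- x"]) simp_all
  qed (simp_all add: algebra_simps)
  fix a :: 'c assume "a \<noteq> \<zero>\<^bsub>field_ring\<^esub>"
  then show "\<exists>b\<in>carrier field_ring. a \<otimes>\<^bsub>field_ring\<^esub> b = \<one>\<^bsub>field_ring\<^esub>"
    by (intro bexI[of _ "inverse a"]) simp_all
qed simp

declare FR.Span.simps [simp del]

lemma FR_minus [simp]: "\<ominus>\<^bsub>field_ring\<^esub> x = - x"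
  by (rule FR.minus_equality) simp_all

locale subfield_set =
  fixes F :: "'c::field set"
  assumes one_mem: "1 \<in> F"
    and add_mem: "x \<in> F \<Longrightarrow> y \<in> F \<Longrightarrow> x + y \<in> F"
    and minus_mem: "x \<in> F \<Longrightarrow> - x \<in> F"
    and mult_mem: "x \<in> F \<Longrightarrow> y \<in> F \<Longrightarrow> x * y \<in> F"
    and inverse_mem: "x \<in> F \<Longrightarrow> inverse x \<in> F"
begin

lemma zero_mem: "0 \<in> F"
  using add_mem[OF one_mem minus_mem[OF one_mem]] by simp

lemma subfield: "subfield F field_ring"
proof (rule FR.subfieldI')
  show "subring F field_ring"
    by (rule FR.subringI) (auto simp: one_mem add_mem minus_mem mult_mem)
  fix k assume k: "k \<in> F - {\<zero>\<^bsub>field_ring\<^esub>}"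
  then have "inverse k = inv\<^bsub>field_ring\<^esub> k"
    by (intro FR.inv_unique') auto
  then show "inv\<^bsub>field_ring\<^esub> k \<in> F" using k inverse_mem[of k] by auto
qed

definition subspace :: "'c set \<Rightarrow> bool" where
  "subspace V \<longleftrightarrow> 0 \<in> V \<and> (\<forall>x\<in>V. \<forall>y\<in>V. x + y \<in> V) \<and> (\<forall>c\<in>F. \<forall>x\<in>V. c * x \<in> V)"

lemma subspace_sum:
  "subspace V \<Longrightarrow> (\<And>i. i \<in> A \<Longrightarrow> f i \<in> V) \<Longrightarrow> sum f A \<in> V"
  by (induction A rule: infinite_finite_induct) (auto simp: subspace_def)

text \<open>A \<open>subalgebra\<close> over \<open>F\<close> is an additive subgroup closed under
  scalars from \<open>F\<close>; closure under negation comes from the scalar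
  \<open>- 1\<close>.\<close>

lemma subspace_iff_subalgebra: "subspace V \<longleftrightarrow> subalgebra F V field_ring"
proof
  assume V: "subspace V"
  show "subalgebra F V field_ring"
  proof (rule subalgebra.intro)
    have "- x \<in> V" if "x \<in> V" for x
      using V that minus_mem[OF one_mem] by (auto simp: subspace_def dest: bspec[of F _ "- 1"])
    then show "subgroup V (add_monoid field_ring)"
      using V by (intro FR.add.subgroupI) (auto simp: subspace_def)
    show "subalgebra_axioms F V field_ring"
      using V by (simp add: subalgebra_axioms_def subspace_def)
  qed
next
  assume V: "subalgebra F V field_ring"
  then have "subgroup V (add_monoid field_ring)" by (rule subalgebra.axioms)
  from subgroup.one_closed[OF this] subgroup.m_closed[OF this] subalgebra.smult_closed[OF V]
  show "subspace V" by (auto simp: subspace_def)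
qed

lemma span_over_subset:
  assumes "subspace V" "S \<subseteq> V"
  shows "span_over F S \<subseteq> V"
proof
  fix x assume "x \<in> span_over F S"
  then obtain B c where B: "B \<subseteq> S" "\<forall>b\<in>B. c b \<in> F" "x = (\<Sum>b\<in>B. c b * b)"
    unfolding span_over_def by blast
  have "c b * b \<in> V" if "b \<in> B" for b
    using B(1,2) assms that unfolding subspace_def by blast
  then show "x \<in> V" unfolding B(3) by (rule subspace_sum[OF assms(1)])
qed

lemma span_over_base: "S \<subseteq> span_over F S"
proof
  fix x assume "x \<in> S"
  then show "x \<in> span_over F S"
    unfolding span_over_def using one_mem
    by (intro CollectI exI[of _ "{x}"] exI[of _ "\<lambda>_. 1"]) auto
qed

lemma subspace_span_over: "subspace (span_over F S)"
  unfolding subspace_def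
proof (intro conjI ballI)
  show "0 \<in> span_over F S"
    unfolding span_over_def by (intro CollectI exI[of _ "{}"]) auto
next
  fix x y assume "x \<in> span_over F S" "y \<in> span_over F S"
  then obtain A c B d where
    A: "finite A" "A \<subseteq> S" "\<forall>b\<in>A. c b \<in> F" "x = (\<Sum>b\<in>A. c b * b)" and
    B: "finite B" "B \<subseteq> S" "\<forall>b\<in>B. d b \<in> F" "y = (\<Sum>b\<in>B. d b * b)"
    unfolding span_over_def by blast
  define e where "e b = (if b \<in> A then c b else 0) + (if b \<in> B then d b else 0)" for b
  have "x + y = (\<Sum>b\<in>A \<union> B. (if b \<in> A then c b * b else 0) + (if b \<in> B then d b * b else 0))"
    using A B by (simp add: sum.distrib sum.If_cases Int_absorb1)
  also have "\<dots> = (\<Sum>b\<in>A \<union> B. e b * b)"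
    by (rule sum.cong) (auto simp: e_def algebra_simps)
  finally show "x + y \<in> span_over F S"
    unfolding span_over_def using A B
    by (intro CollectI exI[of _ "A \<union> B"] exI[of _ e]) (auto simp: e_def add_mem zero_mem)
next
  fix a x assume "a \<in> F" "x \<in> span_over F S"
  then obtain A c where A: "finite A" "A \<subseteq> S" "\<forall>b\<in>A. c b \<in> F" "x = (\<Sum>b\<in>A. c b * b)"
    unfolding span_over_def by blast
  then show "a * x \<in> span_over F S"
    unfolding span_over_def using \<open>a \<in> F\<close>
    by (intro CollectI exI[of _ A] exI[of _ "\<lambda>b. a * c b"])
      (auto simp: mult_mem sum_distrib_left mult.assoc)
qed

lemma Span_eq: "FR.Span F Us = span_over F (set Us)"
proof
  show "FR.Span F Us \<subseteq> span_over F (set Us)"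
    using FR.subalgebra_Span_incl[OF subfield] subspace_span_over span_over_base
    by (auto simp flip: subspace_iff_subalgebra)
  have "subspace (FR.Span F Us)"
    using FR.Span_is_subalgebra[OF subfield] by (simp add: subspace_iff_subalgebra)
  then show "span_over F (set Us) \<subseteq> FR.Span F Us"
    using FR.Span_base_incl[OF subfield] by (intro span_over_subset) auto
qed

lemma dimension_Span_le: "\<exists>n\<le>length Us. FR.dimension n F (FR.Span F Us)"
proof (induction Us)
  case Nil
  show ?case using FR.zero_dim[of F] by (simp add: FR.Span.simps)
next
  case (Cons u Us)
  then obtain n where n: "n \<le> length Us" "FR.dimension n F (FR.Span F Us)" by blast
  show ?case
  proof (cases "u \<in> FR.Span F Us")
    case True
    have "FR.Span F (u # Us) = FR.Span F Us"
    proof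
      show "FR.Span F (u # Us) \<subseteq> FR.Span F Us"
        using True FR.Span_base_incl[OF subfield, of Us]
        by (intro FR.mono_Span_subset[OF subfield]) auto
      show "FR.Span F Us \<subseteq> FR.Span F (u # Us)"
        by (intro FR.mono_Span[OF subfield]) auto
    qed
    with n show ?thesis by (metis le_SucI length_Cons)
  next
    case False
    then have "FR.dimension (Suc n) F (FR.Span F (u # Us))"
      using FR.Suc_dim[OF _ False n(2)] by (simp add: FR.Span.simps)
    with n(1) show ?thesis by (intro exI[of _ "Suc n"]) simp
  qed
qed

lemma dim_over_le:
  assumes "finite B" "B \<subseteq> span_over F S" "S \<subseteq> span_over F B"
  shows "dim_over F S \<le> card B"
  unfolding dim_over_def
  using assms span_over_subset[OF subspace_span_over] by (intro Least_le) blast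

lemma dim_over_dimension_le:
  assumes "FR.dimension n F V"
  shows "dim_over F V \<le> n"
proof -
  obtain Us where Us: "FR.independent F Us" "length Us = n" "FR.Span F Us = V"
    using FR.exists_base[OF subfield assms] by blast
  have "subspace V"
    using Us FR.Span_is_subalgebra[OF subfield, of Us] by (simp add: subspace_iff_subalgebra)
  then have "dim_over F V \<le> card (set Us)"
    using Us span_over_base
    by (intro dim_over_le) (auto simp: Span_eq)
  also have "\<dots> \<le> n" using Us(2) card_length by blast
  finally show ?thesis .
qed

text \<open>A basis shows that the minimum defining \<open>dim_over\<close> is attained, and the
  empty set generates only 0. Positivity matters because this dimension occurs as a divisor.\<close>

lemma dim_over_pos:
  assumes "FR.dimension n F V" "x \<in> V" "x \<noteq> 0"
  shows "dim_over F V > 0"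
proof -
  obtain Us where Us: "FR.Span F Us = V"
    using FR.exists_base[OF subfield assms(1)] by blast
  have V: "subspace V"
    using Us FR.Span_is_subalgebra[OF subfield, of Us] by (simp add: subspace_iff_subalgebra)
  let ?P = "\<lambda>n. \<exists>B. finite B \<and> card B = n \<and> B \<subseteq> span_over F V \<and> span_over F V \<subseteq> span_over F B"
  have "?P (card (set Us))"
    using Us span_over_base[of V] span_over_base[of "set Us"] span_over_subset[OF V, of V]
    by (intro exI[of _ "set Us"]) (auto simp: Span_eq)
  then have "?P (dim_over F V)" unfolding dim_over_def by (rule LeastI)
  then obtain B where B: "finite B" "card B = dim_over F V" "span_over F V \<subseteq> span_over F B" by blast
  show ?thesis
  proof (rule ccontr)
    assume "\<not> dim_over F V > 0"
    then have "B = {}" using B by simp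
    then have "x \<in> span_over F {}" using B assms(2) span_over_base[of V] by auto
    then show False using assms(3) by (auto simp: span_over_def)
  qed
qed

text \<open>An injective endomorphism of a finite-dimensional space is surjective.\<close>
lemma mult_surj_on_span:
  assumes "\<And>v. v \<in> span_over F (set Us) \<Longrightarrow> v * y \<in> span_over F (set Us)"
    and "y \<noteq> 0" "v \<in> span_over F (set Us)"
  shows "v / y \<in> span_over F (set Us)"
proof -
  define V where "V = span_over F (set Us)"
  obtain Vs where Vs: "FR.independent F Vs" "FR.Span F Vs = V"
    using FR.filter_base[OF subfield, of Us] by (auto simp: V_def Span_eq)
  define Ws where "Ws = map (\<lambda>u. u * y) Vs"
  have comb: "FR.combine Ks Ws = FR.combine Ks Vs * y" for Ks
    using FR.combine_l_distr[of Ks Vs y] by (simp add: Ws_def)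
  have "FR.independent F Ws"
  proof (rule FR.trivial_combine_imp_independent[OF subfield])
    fix Ks assume Ks: "set Ks \<subseteq> F" "FR.combine Ks Ws = \<zero>\<^bsub>field_ring\<^esub>"
    have "FR.combine Ks Vs = 0" using Ks(2) assms(2) unfolding comb by simp
    with Ks(1) show "set (take (length Ws) Ks) \<subseteq> {\<zero>\<^bsub>field_ring\<^esub>}"
      using FR.independent_imp_trivial_combine[OF subfield Vs(1)] by (simp add: Ws_def)
  qed simp
  moreover have "set Vs \<subseteq> V"
    using FR.Span_base_incl[OF subfield, of Vs] Vs(2) by simp
  then have "set Ws \<subseteq> V" using assms(1) by (auto simp: Ws_def V_def)
  moreover have "FR.dimension (length Ws) F V"
    using FR.dimensionI[OF subfield Vs] by (simp add: Ws_def)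
  ultimately have "FR.Span F Ws = V"
    using FR.independent_length_eq_dimension[OF subfield] by blast
  then have "v \<in> FR.Span F Ws" using assms(3) by (simp add: V_def)
  then obtain Ks where "set Ks \<subseteq> F" "v = FR.combine Ks Ws"
    using FR.Span_eq_combine_set[OF subfield, of Ws] by auto
  then have "v / y = FR.combine Ks Vs" "FR.combine Ks Vs \<in> V"
    using Vs(2) FR.Span_eq_combine_set[OF subfield, of Vs] assms(2) by (auto simp: comb)
  then show ?thesis by (simp add: V_def)
qed

end

section \<open>The field \<open>K_rho\<close> and the dimension bound\<close>

lemma subfield_set_fractions:
  fixes A :: "'c::field set"
  assumes "1 \<in> A" "\<And>x y. x \<in> A \<Longrightarrow> y \<in> A \<Longrightarrow> x + y \<in> A" "\<And>x. x \<in> A \<Longrightarrow> - x \<in> A"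
    "\<And>x y. x \<in> A \<Longrightarrow> y \<in> A \<Longrightarrow> x * y \<in> A"
  shows "subfield_set {x / y | x y. x \<in> A \<and> y \<in> A \<and> y \<noteq> 0}"
proof
  let ?F = "{x / y | x y. x \<in> A \<and> y \<in> A \<and> y \<noteq> 0}"
  show "1 \<in> ?F" using assms(1) by (intro CollectI exI[of _ 1]) auto
  fix x y assume "x \<in> ?F"
  then obtain a b where x: "x = a / b" "a \<in> A" "b \<in> A" "b \<noteq> 0" by blast
  show "- x \<in> ?F" using x assms by (intro CollectI exI[of _ "- a"] exI[of _ b]) auto
  show "inverse x \<in> ?F"
  proof (cases "a = 0")
    case True
    then show ?thesis using x by (intro CollectI exI[of _ a] exI[of _ b]) auto
  next
    case False
    then show ?thesis using x by (intro CollectI exI[of _ b] exI[of _ a]) auto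
  qed
  assume "y \<in> ?F"
  then obtain c d where y: "y = c / d" "c \<in> A" "d \<in> A" "d \<noteq> 0" by blast
  show "x + y \<in> ?F" using x y assms
    by (intro CollectI exI[of _ "a * d + c * b"] exI[of _ "b * d"]) (auto simp: field_simps)
  show "x * y \<in> ?F" using x y assms
    by (intro CollectI exI[of _ "a * c"] exI[of _ "b * d"]) auto
qed

lemma subfield_set_K_rho:
  assumes "\<And>x y. x \<in> L \<Longrightarrow> y \<in> L \<Longrightarrow> x + y \<in> L" "\<And>x. x \<in> L \<Longrightarrow> - x \<in> L"
  shows "subfield_set (K_rho L)"
  unfolding K_rho_def using assms
  by (intro subfield_set_fractions) (auto simp: EndLam_def distrib_right mult.assoc)

text \<open>The \<open>k\<close>-span \<open>V\<close> of \<open>\<omega>\<close> is a \<open>K\<^sub>\<rho>\<close>-space, of \<open>K\<^sub>\<rho>\<close>-dimension at most \<open>r / s\<close> by the tower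
  law; a nontrivial relation \<open>\<Sum>b\<^sub>i u\<^sub>i \<in> V\<close> then leaves at most \<open>r / s + n - 1\<close> generators.\<close>
lemma dim_over_span_less:
  fixes L k :: "'c::field set" and \<omega> u :: "nat \<Rightarrow> 'c"
  assumes k: "subfield_set k" "k \<subseteq> K_rho L"
    and L: "\<And>x y. x \<in> L \<Longrightarrow> y \<in> L \<Longrightarrow> x + y \<in> L" "\<And>x. x \<in> L \<Longrightarrow> - x \<in> L"
    and \<omega>: "\<And>i. i < r \<Longrightarrow> \<omega> i \<in> L" "L \<subseteq> span_over k (\<omega> ` {..<r})" "0 < r" "\<omega> 0 \<noteq> 0"
    and b: "\<And>i. i < n \<Longrightarrow> b i \<in> K_rho L" "i0 < n" "b i0 \<noteq> 0" "(\<Sum>i<n. b i * u i) \<in> L"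
  shows "real (dim_over (K_rho L) (\<omega> ` {..<r} \<union> u ` {..<n}))
    < real r / real (dim_over k (K_rho L)) + real n"
proof -
  define K where "K = K_rho L"
  interpret k: subfield_set k by (rule k)
  interpret K: subfield_set K unfolding K_def using L by (rule subfield_set_K_rho)
  have kK: "k \<subseteq> K" and bK: "\<And>i. i < n \<Longrightarrow> b i \<in> K"
    using k(2) b(1) by (simp_all add: K_def)
  define ws where "ws = map \<omega> [0..<r]"
  have set_ws: "set ws = \<omega> ` {..<r}" by (auto simp: ws_def)
  define V where "V = span_over k (\<omega> ` {..<r})"
  have V_k: "k.subspace V" unfolding V_def by (rule k.subspace_span_over)
  have V_Span: "V = FR.Span k ws" by (simp add: V_def k.Span_eq set_ws)
  have End_V: "c * v \<in> V" if "c \<in> EndLam L" "v \<in> V" for c v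
  proof -
    \<comment> \<open>The elements that \<open>c\<close> maps into \<open>V\<close> form a
      \<open>k\<close>-space, so it suffices to treat the generators.\<close>
    have "k.subspace {v. c * v \<in> V}"
      using V_k by (auto simp: k.subspace_def distrib_left mult.left_commute)
    moreover have "\<omega> ` {..<r} \<subseteq> {v. c * v \<in> V}"
      using that(1) \<omega>(1,2) by (auto simp: EndLam_def V_def)
    ultimately show ?thesis using k.span_over_subset that(2) unfolding V_def by blast
  qed
  have K_V: "c * v \<in> V" if c: "c \<in> K" and v: "v \<in> V" for c v
  proof -
    obtain x y where xy: "c = x / y" "x \<in> EndLam L" "y \<in> EndLam L" "y \<noteq> 0"
      using c by (auto simp: K_def K_rho_def)
    \<comment> \<open>The numerator \<open>x\<close> preserves \<open>V\<close> directly; division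
      by \<open>y\<close> does so because multiplication by \<open>y\<close> is injective on the
      finite-dimensional space \<open>V\<close>.\<close>
    have "w * y \<in> V" if "w \<in> V" for w
      using End_V[OF xy(3) that] by (simp add: mult.commute)
    then have "(x * v) / y \<in> V"
      using k.mult_surj_on_span[of ws y "x * v"] End_V[OF xy(2) v] xy(4) by (simp add: V_def set_ws)
    then show ?thesis by (simp add: xy)
  qed
  have V_K: "K.subspace V" using V_k K_V unfolding K.subspace_def k.subspace_def by blast
  have V_span_K: "V = span_over K (\<omega> ` {..<r})"
  proof
    have "k.subspace (span_over K (\<omega> ` {..<r}))"
      using K.subspace_span_over[of "\<omega> ` {..<r}"] kK
      unfolding K.subspace_def k.subspace_def by blast
    then show "V \<subseteq> span_over K (\<omega> ` {..<r})"
      unfolding V_def by (rule k.span_over_subset) (rule K.span_over_base)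
    show "span_over K (\<omega> ` {..<r}) \<subseteq> V"
      using V_K by (rule K.span_over_subset) (unfold V_def, rule k.span_over_base)
  qed

  obtain r' where r': "r' \<le> r" "FR.dimension r' k V"
    using k.dimension_Span_le[of ws] by (auto simp: V_Span ws_def)
  obtain d where d: "FR.dimension d K V"
    using K.dimension_Span_le[of ws] by (auto simp: V_span_K K.Span_eq set_ws)
  obtain s' where s': "FR.dimension s' k K"
  proof -
    \<comment> \<open>Multiplication by \<open>\<omega> 0\<close> embeds \<open>K\<close> into
      \<open>V\<close>, so \<open>K\<close> lies in the \<open>k\<close>-span of the generators
      divided by \<open>\<omega> 0\<close> and is finite-dimensional.\<close>
    define ws' where "ws' = map (\<lambda>w. w * (1 / \<omega> 0)) ws"
    have "K \<subseteq> FR.Span k ws'"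
    proof
      fix c assume "c \<in> K"
      moreover have "\<omega> 0 \<in> V" using \<omega>(1-3) by (auto simp: V_def)
      ultimately have "c * \<omega> 0 \<in> FR.Span k ws" using K_V V_Span by simp
      then obtain Ks where "set Ks \<subseteq> k" "c * \<omega> 0 = FR.combine Ks ws"
        using FR.Span_eq_combine_set[OF k.subfield, of ws] by auto
      moreover have "c = c * \<omega> 0 * (1 / \<omega> 0)" using \<omega>(4) by simp
      ultimately have "c = FR.combine Ks ws'" "set Ks \<subseteq> k"
        using FR.combine_l_distr[of Ks ws "1 / \<omega> 0"] by (simp_all add: ws'_def)
      then show "c \<in> FR.Span k ws'"
        using FR.Span_eq_combine_set[OF k.subfield, of ws'] by auto
    qed
    moreover have "k.subspace K"
      using K.zero_mem K.add_mem K.mult_mem kK unfolding k.subspace_def by blast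
    ultimately have "FR.finite_dimension k K"
      using FR.subalbegra_incl_imp_finite_dimension[OF k.subfield
          FR.Span_finite_dimension[OF k.subfield, of ws']]
      by (auto simp: k.subspace_iff_subalgebra)
    then show ?thesis using that by (rule FR.finite_dimensionE')
  qed
  have "s' * d = r'"
    using FR.telescopic_base[OF k.subfield K.subfield s' d] r'(2)
    by (rule FR.dimension_is_inj[OF k.subfield])
  define s where "s = dim_over k K"
  \<comment> \<open>\<open>s\<close> is a least number of generators and \<open>s'\<close> the size
    of a basis; the bound \<open>s \<le> s'\<close> suffices for
    \<open>d \<le> r / s\<close>.\<close>
  have s: "0 < s" "s \<le> s'"
    using k.dim_over_pos[OF s' K.one_mem] k.dim_over_dimension_le[OF s'] by (simp_all add: s_def)
  have "s * d \<le> r" using \<open>s' * d = r'\<close> r'(1) s(2) by (meson le_trans mult_le_mono1)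
  then have "real s * real d \<le> real r" by (simp flip: of_nat_mult)
  then have d_le: "real d \<le> real r / real s" using s(1) by (simp add: field_simps)

  obtain Vs where Vs: "length Vs = d" "FR.Span K Vs = V"
    using FR.exists_base[OF K.subfield d] by blast
  \<comment> \<open>Generators of \<open>V\<close> over \<open>K\<close> and all \<open>u i\<close>
    except \<open>u i0\<close>, which the relation recovers because \<open>b i0\<close> is
    invertible.\<close>
  define B where "B = set Vs \<union> u ` ({..<n} - {i0})"
  define W where "W = span_over K (\<omega> ` {..<r} \<union> u ` {..<n})"
  have W: "K.subspace W" unfolding W_def by (rule K.subspace_span_over)
  have SB: "K.subspace (span_over K B)" by (rule K.subspace_span_over)
  have V_B: "V \<subseteq> span_over K B"
    unfolding Vs(2)[symmetric] K.Span_eq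
    by (rule K.span_over_subset[OF SB]) (use K.span_over_base[of B] in \<open>auto simp: B_def\<close>)
  have "V \<subseteq> W"
    unfolding V_span_K
    by (rule K.span_over_subset[OF W]) (use K.span_over_base[of "\<omega> ` {..<r} \<union> u ` {..<n}"] in \<open>auto simp: W_def\<close>)
  moreover have "set Vs \<subseteq> V" using Vs(2) K.span_over_base[of "set Vs"] by (simp add: K.Span_eq)
  ultimately have "B \<subseteq> W"
    using K.span_over_base[of "\<omega> ` {..<r} \<union> u ` {..<n}"] by (auto simp: B_def W_def)
  have u_B: "u i \<in> span_over K B" if "i < n" "i \<noteq> i0" for i
    using K.span_over_base[of B] that by (auto simp: B_def)
  have "u i0 \<in> span_over K B"
  proof -
    have "(\<Sum>i<n. b i * u i) = b i0 * u i0 + (\<Sum>i\<in>{..<n} - {i0}. b i * u i)"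
      using b(2) by (simp add: sum.remove)
    then have "u i0 = inverse (b i0) * ((\<Sum>i<n. b i * u i) + (- 1) * (\<Sum>i\<in>{..<n} - {i0}. b i * u i))"
      using b(3) by simp
    moreover have "(\<Sum>i<n. b i * u i) \<in> span_over K B"
      using b(4) \<omega>(2) V_B by (auto simp: V_def)
    moreover have "(\<Sum>i\<in>{..<n} - {i0}. b i * u i) \<in> span_over K B"
      using u_B SB bK by (intro K.subspace_sum[OF SB]) (simp add: K.subspace_def)
    moreover have "inverse (b i0) \<in> K" "- 1 \<in> K"
      using bK[OF b(2)] K.inverse_mem K.minus_mem[OF K.one_mem] by auto
    moreover have "c * (x + d * y) \<in> span_over K B"
      if "c \<in> K" "d \<in> K" "x \<in> span_over K B" "y \<in> span_over K B" for c d x y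
      using SB that unfolding K.subspace_def by blast
    ultimately show ?thesis by metis
  qed
  then have "u ` {..<n} \<subseteq> span_over K B" using u_B by auto
  moreover have "\<omega> ` {..<r} \<subseteq> span_over K B"
    using V_B k.span_over_base[of "\<omega> ` {..<r}"] by (auto simp: V_def)
  ultimately have "dim_over K (\<omega> ` {..<r} \<union> u ` {..<n}) \<le> card B"
    using \<open>B \<subseteq> W\<close> by (intro K.dim_over_le) (auto simp: W_def B_def)
  also have "card B \<le> card (set Vs) + card (u ` ({..<n} - {i0}))"
    unfolding B_def by (rule card_Un_le)
  also have "\<dots> \<le> d + card ({..<n} - {i0})"
    using card_length[of Vs] Vs(1) card_image_le[of "{..<n} - {i0}" u] by simp
  also have "\<dots> < d + n" using b(2) by simp
  finally have "real (dim_over K (\<omega> ` {..<r} \<union> u ` {..<n})) < real d + real n"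
    by (simp flip: of_nat_add)
  with d_le show ?thesis by (simp add: K_def s_def)
qed


section \<open>Trivial extensions and linear relations among logarithms\<close>

context drinfeld
begin

lemma Phi_row:
  assumes "Suc j < r"
  shows "(\<Sum>m<r. Phi_rho q \<theta> r \<kappa> j m * f m) = f (Suc j)"
proof -
  have "(\<Sum>m<r. Phi_rho q \<theta> r \<kappa> j m * f m) = (\<Sum>m<r. if m = Suc j then f (Suc j) else 0)"
    using assms by (intro sum.cong) (auto simp: Phi_rho_def)
  then show ?thesis using assms by simp
qed

lemma Phi_last_row:
  "(\<Sum>m<r. Phi_rho q \<theta> r \<kappa> (r - 1) m * f m) =
    to_fract tmt * f 0 - (\<Sum>m\<in>{1..<r}. to_fract [:kap m:] * f m)"
proof -
  have "(\<Sum>m<r. Phi_rho q \<theta> r \<kappa> (r - 1) m * f m) =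
      to_fract tmt * f 0 + (\<Sum>m\<in>{1..<r}. Phi_rho q \<theta> r \<kappa> (r - 1) m * f m)"
    using r_pos unfolding Phi_last_0[symmetric]
    by (simp add: lessThan_atLeast0 sum.atLeast_Suc_lessThan)
  also have "(\<Sum>m\<in>{1..<r}. Phi_rho q \<theta> r \<kappa> (r - 1) m * f m) =
      (\<Sum>m\<in>{1..<r}. - (to_fract [:kap m:] * f m))"
    by (intro sum.cong refl) (simp add: Phi_last del: One_nat_def)
  finally show ?thesis by (simp add: sum_negf)
qed

text \<open>Every row arises from the first by iterating \<open>sig\<close>; used in contrapositive
  form, to find a nonzero entry in the first row of a nonzero matrix.\<close>

lemma row_zero:
  assumes row: "\<And>m l. Suc m < r \<Longrightarrow> l < r \<Longrightarrow> M (Suc m) l = sig (M m) l"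
    and zero: "\<And>l. l < r \<Longrightarrow> M 0 l = 0" and "m < r" "l < r"
  shows "M m l = 0"
  using assms(3,4)
proof (induction m arbitrary: l)
  case (Suc m)
  then have "M m l' = 0" if "l' < r" for l' using that by simp
  then show ?case using Suc.prems r_pos by (simp add: row sig_def)
qed (rule zero)

section \<open>Closure properties of the constants and of k\<close>

lemma Fq_closed:
  "0 \<in> Fq q" "(1 :: 'c) \<in> Fq q" "a \<in> Fq q \<Longrightarrow> (b :: 'c) \<in> Fq q \<Longrightarrow> a + b \<in> Fq q"
  "a \<in> Fq q \<Longrightarrow> - (a :: 'c) \<in> Fq q" "a \<in> Fq q \<Longrightarrow> (b :: 'c) \<in> Fq q \<Longrightarrow> a * b \<in> Fq q"
  using frob_power_minus[of a 1] by (simp_all add: Fq_def frob_add power_mult_distrib)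

lemma subfield_set_kset: "subfield_set (kset q \<theta>)"
  unfolding kset_def
proof (rule subfield_set_fractions)
  show "1 \<in> Aset q \<theta>"
    unfolding Aset_def by (intro CollectI exI[of _ 1]) (simp add: Fq_closed coeff_1)
  fix x assume "x \<in> Aset q \<theta>"
  then obtain a where a: "x = poly a \<theta>" "\<And>i. coeff a i \<in> Fq q" by (auto simp: Aset_def)
  show "- x \<in> Aset q \<theta>"
    unfolding Aset_def by (intro CollectI exI[of _ "- a"]) (simp add: a Fq_closed)
  fix y assume "y \<in> Aset q \<theta>"
  then obtain b where b: "y = poly b \<theta>" "\<And>i. coeff b i \<in> Fq q" by (auto simp: Aset_def)
  show "x + y \<in> Aset q \<theta>"
    unfolding Aset_def by (intro CollectI exI[of _ "a + b"]) (simp add: a b Fq_closed)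
  have "sum f A \<in> Fq q" if "\<And>i. i \<in> A \<Longrightarrow> f i \<in> Fq q" for f :: "nat \<Rightarrow> 'c" and A
    using that by (induction A rule: infinite_finite_induct) (auto simp: Fq_closed)
  then show "x * y \<in> Aset q \<theta>"
    unfolding Aset_def by (intro CollectI exI[of _ "a * b"]) (simp add: a b Fq_closed coeff_mult)
qed

end

context drinfeld_exp
begin

text \<open>Induction on the coefficients: constants pass through \<open>expo\<close> by linearity
  over \<open>Fq q\<close>, and multiplication by \<theta> turns into \<open>rho\<close>, which
  fixes 0.\<close>

lemma Aset_subset_EndLam: "Aset q \<theta> \<subseteq> EndLam (Lambda expo)"
proof
  fix x assume "x \<in> Aset q \<theta>"
  then obtain a where a: "x = poly a \<theta>" "\<forall>i. coeff a i \<in> Fq q" by (auto simp: Aset_def)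
  have "expo (poly a \<theta> * l) = 0" if "expo l = 0" for l
    using a(2)
  proof (induction a)
    case (pCons c a)
    have "c \<in> Fq q" using spec[OF pCons.prems, of 0] by simp
    moreover have "\<forall>i. coeff a i \<in> Fq q"
    proof
      fix i show "coeff a i \<in> Fq q" using spec[OF pCons.prems, of "Suc i"] by simp
    qed
    then have "expo (poly a \<theta> * l) = 0" by (rule pCons.IH)
    ultimately have "expo (c * l + \<theta> * (poly a \<theta> * l)) = 0"
      using that by (simp add: expo_add expo_Fq expo_theta)
    then show ?case by (simp add: algebra_simps)
  qed simp
  then show "x \<in> EndLam (Lambda expo)" by (simp add: a(1) EndLam_def Lambda_def)
qed

lemma kset_subset_K_rho: "kset q \<theta> \<subseteq> K_rho (Lambda expo)"
  using Aset_subset_EndLam unfolding kset_def K_rho_def by blast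

lemma dim_over_less_if_relation:
  assumes basis: "is_A_basis q \<theta> (Lambda expo) r \<omega>"
    and b: "\<And>i. i < n \<Longrightarrow> b i \<in> EndLam (Lambda expo)" "i0 < n" "b i0 \<noteq> 0"
      "expo (\<Sum>i<n. b i * u i) = 0"
  shows "real (dim_over (K_rho (Lambda expo)) (\<omega> ` {..<r} \<union> u ` {..<n}))
    < real r / real (dim_over (kset q \<theta>) (K_rho (Lambda expo))) + real n"
proof (rule dim_over_span_less)
  interpret k: subfield_set "kset q \<theta>" by (rule subfield_set_kset)
  have one_A: "1 \<in> Aset q \<theta>"
    unfolding Aset_def by (intro CollectI exI[of _ 1]) (simp add: Fq_closed coeff_1)
  have zero_A: "0 \<in> Aset q \<theta>"
    unfolding Aset_def by (intro CollectI exI[of _ 0]) (simp add: Fq_closed)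
  show "subfield_set (kset q \<theta>)" by (rule subfield_set_kset)
  show "kset q \<theta> \<subseteq> K_rho (Lambda expo)" by (rule kset_subset_K_rho)
  show "x + y \<in> Lambda expo" if "x \<in> Lambda expo" "y \<in> Lambda expo" for x y
    using that by (simp add: Lambda_def expo_add)
  show "- x \<in> Lambda expo" if "x \<in> Lambda expo" for x
    using that by (simp add: Lambda_def expo_minus)
  show "\<omega> i \<in> Lambda expo" if "i < r" for i using basis that by (simp add: is_A_basis_def)
  show "0 < r" using r_pos by simp
  show "Lambda expo \<subseteq> span_over (kset q \<theta>) (\<omega> ` {..<r})"
  proof
    fix l assume "l \<in> Lambda expo"
    then have "\<exists>!a. (\<forall>i<r. a i \<in> Aset q \<theta>) \<and> (\<forall>i\<ge>r. a i = 0) \<and> l = (\<Sum>i<r. a i * \<omega> i)"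
      using basis by (simp add: is_A_basis_def)
    from ex1_implies_ex[OF this]
    obtain a where a: "\<forall>i<r. a i \<in> Aset q \<theta>" "l = (\<Sum>i<r. a i * \<omega> i)" by auto
    have "a i * \<omega> i \<in> span_over (kset q \<theta>) (\<omega> ` {..<r})" if "i < r" for i
    proof -
      have "a i \<in> kset q \<theta>"
        using a(1) one_A that unfolding kset_def by (intro CollectI exI[of _ "a i"] exI[of _ 1]) simp
      moreover have "\<omega> i \<in> span_over (kset q \<theta>) (\<omega> ` {..<r})"
        by (rule subsetD[OF k.span_over_base]) (simp add: that)
      ultimately show ?thesis
        using k.subspace_span_over[of "\<omega> ` {..<r}"] unfolding k.subspace_def by simp
    qed
    then show "l \<in> span_over (kset q \<theta>) (\<omega> ` {..<r})"
      unfolding a(2) by (intro k.subspace_sum[OF k.subspace_span_over]) simp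
  qed
  \<comment> \<open>If \<open>\<omega> 0\<close> were 0, the zero vector and the first unit vector
    would both be coordinates of the lattice point 0.\<close>
  show "\<omega> 0 \<noteq> 0"
  proof
    assume \<omega>0: "\<omega> 0 = 0"
    define P where "P a \<longleftrightarrow> (\<forall>i<r. a i \<in> Aset q \<theta>) \<and> (\<forall>i\<ge>r. a i = 0) \<and> 0 = (\<Sum>i<r. a i * \<omega> i)" for a
    have "0 \<in> Lambda expo" by (simp add: Lambda_def)
    then have ex1: "\<exists>!a. P a" using basis unfolding is_A_basis_def P_def by (elim conjE bspec)
    have P1: "P (\<lambda>_. 0)" using zero_A by (simp add: P_def)
    have P2: "P (\<lambda>i. if i = 0 then 1 else 0)"
    proof -
      have "(\<Sum>i<r. (if i = 0 then 1 else 0) * \<omega> i) = 0" using \<omega>0 by (intro sum.neutral) auto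
      then show ?thesis using zero_A one_A r_pos by (simp add: P_def)
    qed
    from ex1 obtain a where "\<And>a'. P a' \<Longrightarrow> a' = a" by (elim ex1E) blast
    from this[OF P1] this[OF P2] have "(\<lambda>_. 0) = (\<lambda>i :: nat. if i = 0 then 1 else (0 :: 'c))"
      by simp
    from fun_cong[OF this, of 0] show False by simp
  qed
  show "b i \<in> K_rho (Lambda expo)" if "i < n" for i
  proof -
    have "1 \<in> EndLam (Lambda expo)" by (simp add: EndLam_def)
    then show ?thesis using b(1)[OF that]
      unfolding K_rho_def by (intro CollectI exI[of _ "b i"] exI[of _ 1]) simp
  qed
  show "i0 < n" "b i0 \<noteq> 0" "(\<Sum>i<n. b i * u i) \<in> Lambda expo"
    using b by (simp_all add: Lambda_def)
qed

text \<open>Applying \<open>eps\<close> to \<open>triv\<close> cancels \<open>sig g\<close> against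
  \<open>g\<close> and leaves a vanishing sum of the values at \<open>\<alpha> i\<close> of the
  polynomials attached to the first rows. By \<open>poly_expo\<close> their linear coefficients
  serve as the \<open>b i\<close>.\<close>

lemma relation_if_split:
  assumes row: "\<And>i m l. i < n \<Longrightarrow> Suc m < r \<Longrightarrow> l < r \<Longrightarrow> M i (Suc m) l = sig (M i m) l"
    and last: "\<And>i l. i < n \<Longrightarrow> l < r \<Longrightarrow> tmt * M i 0 l =
      (\<Sum>m\<in>{1..<r}. smult (kap m) (M i m l)) + sig (M i (r - 1)) l"
    and triv: "\<And>l. l < r \<Longrightarrow> sig g l + (\<Sum>i<n. smult (\<alpha> i) (M i 0 l)) = g l"
    and u: "\<And>i. i < n \<Longrightarrow> expo (u i) = \<alpha> i"
    and nonzero: "i0 < n" "j < r" "l < r" "M i0 j l \<noteq> 0"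
  obtains b where "\<And>i. i < n \<Longrightarrow> b i \<in> EndLam (Lambda expo)" "b i0 \<noteq> 0"
    "expo (\<Sum>i<n. b i * u i) = 0"
proof
  define P where "P i = row_poly (M i 0)" for i
  have P0: "coeff (P i) 0 = 0" for i by (simp add: P_def coeff_row_poly_0)
  have comm: "rho (poly (P i) x) = poly (P i) (rho x)" if "i < n" for i x
    unfolding P_def using row last that by (intro row_poly_commute) auto
  have P_expo: "poly (P i) (expo z) = expo (coeff (P i) 1 * z)" if "i < n" for i z
    using P0 comm[OF that] by (rule poly_expo)
  show "coeff (P i) 1 \<in> EndLam (Lambda expo)" if "i < n" for i
    using P_expo[OF that, symmetric] P0[of i]
    by (simp add: EndLam_def Lambda_def poly_0_coeff_0)
  \<comment> \<open>\<open>row_poly\<close> sees only the first row, so the nonzero entry has to be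
    found there.\<close>
  obtain l' where "l' < r" "M i0 0 l' \<noteq> 0"
  proof (rule ccontr)
    assume "\<not> thesis"
    with that have zero: "M i0 0 l' = 0" if "l' < r" for l' using \<open>l' < r\<close> by blast
    have "M i0 j l = 0"
      using row[OF nonzero(1)] zero nonzero(2,3) by (rule row_zero)
    with nonzero(4) show False by simp
  qed
  then have "P i0 \<noteq> 0" unfolding P_def by (rule row_poly_nonzero)
  then show "coeff (P i0) 1 \<noteq> 0"
    using coeff_1_nonzero[OF P0 comm[OF nonzero(1)]] by simp
  have "eps g = eps (\<lambda>l. sig g l + (\<Sum>i<n. smult (\<alpha> i) (M i 0 l)))"
    by (rule eps_cong) (simp add: triv)
  also have "\<dots> = eps g + (\<Sum>i<n. poly (P i) (\<alpha> i))"
    by (simp add: eps_add eps_sum eps_sig P_def poly_row_poly)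
  finally have "0 = (\<Sum>i<n. poly (P i) (\<alpha> i))" by simp
  also have "(\<Sum>i<n. poly (P i) (\<alpha> i)) = (\<Sum>i<n. expo (coeff (P i) 1 * u i))"
    by (rule sum.cong[OF refl]) (metis lessThan_iff P_expo u)
  finally show "expo (\<Sum>i<n. coeff (P i) 1 * u i) = 0"
    by (simp only: expo_sum)
qed

text \<open>As |\<theta>| > 1, powers of \<theta> with different exponents have different absolute
  values.\<close>

lemma aperiodic:
  assumes "n \<ge> 1"
  shows "\<theta> ^ q ^ n \<noteq> \<theta>"
proof -
  have "1 < q ^ n" using assms q_ge_2 by (intro one_less_power) auto
  then have "absv \<theta> ^ 1 < absv \<theta> ^ q ^ n" using theta_gt_1 by (intro power_strict_increasing) auto
  then show ?thesis by (metis absv_power less_irrefl power_one_right)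
qed

end

text \<open>The prime characteristic gives additivity, and a root of X^q - x, which exists by
  algebraic closedness, gives surjectivity.\<close>

lemma perfect_frobenius_Cinf:
  fixes \<theta> :: "'c::field"
  assumes "Cinf_data q \<theta> absv"
  shows "perfect_frobenius TYPE('c) q"
proof
  obtain p e where p: "prime p" "e > 0" "q = p ^ e" "CHAR('c) = p"
    using assms by (auto simp: Cinf_data_def)
  have "p ^ 1 \<le> p ^ e" using p(1,2) prime_ge_1_nat[OF p(1)] by (intro power_increasing) auto
  then show q2: "q \<ge> 2" using prime_ge_2_nat[OF p(1)] p(3) by simp
  show "(x + y :: 'c) ^ q = x ^ q + y ^ q" for x y
    using p by (intro freshmans_dream') auto
  fix x :: 'c
  have "degree (monom 1 q + [:- x:]) > 0"
    using q2 by (subst degree_add_eq_left) (simp_all add: degree_monom_eq)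
  moreover have "alg_closed_field TYPE('c)" using assms by (simp add: Cinf_data_def)
  ultimately obtain y where "poly (monom 1 q + [:- x:]) y = 0"
    unfolding alg_closed_field_def by blast
  then show "\<exists>y. y ^ q = x" by (auto simp: poly_monom eq_neg_iff_add_eq_0)
qed

theorem theorem4p2:
  fixes q r n :: nat and \<theta> :: "'c::field" and absv :: "'c \<Rightarrow> real"
    and \<kappa> :: "nat \<Rightarrow> 'c" and expo :: "'c \<Rightarrow> 'c" and \<omega> u \<alpha> :: "nat \<Rightarrow> 'c"
    and E :: "nat \<Rightarrow> nat \<Rightarrow> nat \<Rightarrow> 'c poly fract"
  assumes Cinf: "Cinf_data q \<theta> absv"
    and r_pos: "r \<ge> 1"
    and kappa: "\<forall>i\<in>{1..<r}. \<kappa> i \<in> kbar q \<theta>"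
    and expo: "is_exp_rho q \<theta> absv r \<kappa> expo"
    and basis: "is_A_basis q \<theta> (Lambda expo) r \<omega>"
    and u: "\<forall>i<n. expo (u i) = \<alpha> i \<and> \<alpha> i \<in> kbar q \<theta>"
    and dim: "real (dim_over (K_rho (Lambda expo)) (\<omega> ` {..<r} \<union> u ` {..<n}))
              = real r / real (dim_over (kset q \<theta>) (K_rho (Lambda expo))) + real n"
    and E_in: "\<forall>i<n. \<forall>j<r. \<forall>l<r. E i j l \<in> kbar_t q \<theta>"
    and E_nz: "\<exists>i<n. \<exists>j<r. \<exists>l<r. E i j l \<noteq> 0"
    and E_end: "\<forall>i<n. \<forall>j<r. \<forall>l<r.
                  (\<Sum>m<r. Phi_rho q \<theta> r \<kappa> j m * E i m l)
                  = (\<Sum>m<r. twist_rat q (-1) (E i j m) * Phi_rho q \<theta> r \<kappa> m l)"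
  shows "\<not> (\<exists>\<gamma> :: nat \<Rightarrow> 'c poly fract.
             (\<forall>j<r. \<gamma> j \<in> kbar_t q \<theta>) \<and>
             (\<forall>l<r. (\<Sum>m<r. twist_rat q (-1) (\<gamma> m) * Phi_rho q \<theta> r \<kappa> m l)
                      + (\<Sum>i<n. const_rat (\<alpha> i) * E i 0 l) = \<gamma> l))"
proof
  assume "\<exists>\<gamma> :: nat \<Rightarrow> 'c poly fract.
             (\<forall>j<r. \<gamma> j \<in> kbar_t q \<theta>) \<and>
             (\<forall>l<r. (\<Sum>m<r. twist_rat q (-1) (\<gamma> m) * Phi_rho q \<theta> r \<kappa> m l)
                      + (\<Sum>i<n. const_rat (\<alpha> i) * E i 0 l) = \<gamma> l)"
  then obtain \<gamma> where \<gamma>: "\<forall>l<r. (\<Sum>m<r. twist_rat q (-1) (\<gamma> m) * Phi_rho q \<theta> r \<kappa> m l)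
      + (\<Sum>i<n. const_rat (\<alpha> i) * E i 0 l) = \<gamma> l" by blast
  interpret perfect_frobenius q "TYPE('c)" using perfect_frobenius_Cinf[OF Cinf] by simp
  interpret drinfeld_exp q "TYPE('c)" \<theta> r \<kappa> absv expo
    using r_pos expo Cinf by unfold_locales (auto simp: Cinf_data_def)
  have E_end': "(\<Sum>m<r. Phi_rho q \<theta> r \<kappa> j m * E i m l) = sig_rat (E i j) l"
    if "i < n" "j < r" "l < r" for i j l
    using E_end that by (simp add: sig_rat_def)
  \<comment> \<open>Read row by row, commutation with \<Phi> says that each row of
    \<open>E i\<close> is \<open>sig_rat\<close> of the previous one, while the last row of \<Phi>
    leads back to row 0.\<close>
  have row: "E i (Suc m) l = sig_rat (E i m) l" if "i < n" "Suc m < r" "l < r" for i m l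
    using E_end'[of i m l] that by (simp add: Phi_row)
  have last: "to_fract tmt * E i 0 l =
      (\<Sum>m\<in>{1..<r}. to_fract [:kap m:] * E i m l) + sig_rat (E i (r - 1)) l" if "i < n" "l < r" for i l
    using E_end'[of i "r - 1" l, unfolded Phi_last_row] that r_pos by (simp add: diff_eq_eq add.commute)
  have triv: "sig_rat \<gamma> l + (\<Sum>i<n. to_fract [:\<alpha> i:] * E i 0 l) = \<gamma> l" if "l < r" for l
    using \<gamma> that by (simp add: sig_rat_def const_rat_def to_fract_def)
  show False
  proof (rule clear_denominators[of n E \<gamma> \<alpha>])
    fix D M g
    assume D: "D \<noteq> 0"
      and M: "\<And>i m l. i < n \<Longrightarrow> m < r \<Longrightarrow> l < r \<Longrightarrow> to_fract D * E i m l = to_fract (M i m l)"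
      and M_row: "\<And>i m l. i < n \<Longrightarrow> Suc m < r \<Longrightarrow> l < r \<Longrightarrow> M i (Suc m) l = sig (M i m) l"
      and M_last: "\<And>i l. i < n \<Longrightarrow> l < r \<Longrightarrow> tmt * M i 0 l =
        (\<Sum>m\<in>{1..<r}. smult (kap m) (M i m l)) + sig (M i (r - 1)) l"
      and M_triv: "\<And>l. l < r \<Longrightarrow> sig g l + (\<Sum>i<n. smult (\<alpha> i) (M i 0 l)) = g l"
    obtain i0 j l where i0: "i0 < n" "j < r" "l < r" "E i0 j l \<noteq> 0" using E_nz by blast
    have nonzero: "M i0 j l \<noteq> 0"
      using M[OF i0(1-3)] D i0(4) by (metis mult_eq_0_iff to_fract_eq_0_iff)
    have u': "expo (u i) = \<alpha> i" if "i < n" for i using u that by simp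
    show False
    proof (rule relation_if_split[of n M g \<alpha> u i0 j l])
      fix b assume "\<And>i. i < n \<Longrightarrow> b i \<in> EndLam (Lambda expo)" "b i0 \<noteq> 0"
        "expo (\<Sum>i<n. b i * u i) = 0"
      \<comment> \<open>The relation makes the dimension strictly smaller than the value assumed in
        \<open>dim\<close>.\<close>
      from dim_over_less_if_relation[of \<omega> n b i0 u, OF basis this(1) i0(1) this(2,3)] dim
      show False by simp
    qed (fact M_row M_last M_triv u' i0 nonzero)+
  qed (fact aperiodic row last triv)+
qed


end
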